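(* Let $(\mathfrak{g},\mathfrak{n})$ be a pair of finite-dimensional complex Lie algebras on the same underlying vector space, where $\mathfrak{g}$ is perfect and not semisimple, and $\mathfrak{n}$ is isomorphic to $\mathfrak{sl}_3(\mathbb{C})$. Then there is no PA-structure on $(\mathfrak{g},\mathfrak{n})$.
   Context: A Lie algebra $\mathfrak{g}$ is perfect if $\mathfrak{g}=[\mathfrak{g},\mathfrak{g}]$. Let $\mathfrak{g}=(V,[\,,])$ and $\mathfrak{n}=(V,\{\,,\})$ be two Lie algebra structures on the same vector space $V$ over $\mathbb{C}$. A post-Lie algebra structure (PA-structure) on the pair $(\mathfrak{g},\mathfrak{n})$ is a $\mathbb{C}$-bilinear product $(x,y)\mapsto x\cdot y$ on $V$ satisfying, for all $x,y,z\in V$: (1) $x\cdot y-y\cdot x=[x,y]-\{x,y\}$; (2) $[x,y]\cdot z=x\cdot(y\cdot z)-y\cdot(x\cdot z)$; (3) $x\cdot\{y,z\}=\{x\cdot y,z\}+\{y,x\cdot z\}$. When the algebras of a pair are specified only up to isomorphism, "there is no PA-structure" means that none exists for any two brackets on a common vector space $V$ giving Lie algebras of the specified isomorphism types. *)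

theory Defs
  imports "HOL-Analysis.Analysis"
begin

definition bilinear_over ::
    "('a::field \<Rightarrow> 'v::ab_group_add \<Rightarrow> 'v) \<Rightarrow> ('v \<Rightarrow> 'v \<Rightarrow> 'v) \<Rightarrow> bool"
  where "bilinear_over smul p \<longleftrightarrow>
    (\<forall>x. Vector_Spaces.linear smul smul (\<lambda>y. p x y)) \<and>
    (\<forall>y. Vector_Spaces.linear smul smul (\<lambda>x. p x y))"

locale lie_algebra = vector_space smul
  for smul :: "'a::field \<Rightarrow> 'v::ab_group_add \<Rightarrow> 'v" +
  fixes bracket :: "'v \<Rightarrow> 'v \<Rightarrow> 'v"
  assumes bilinear: "bilinear_over smul bracket"
    and alternating: "bracket x x = 0"
    and jacobi: "bracket x (bracket y z) + bracket y (bracket z x) + bracket z (bracket x y) = 0"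
begin

definition bracket_span :: "'v set \<Rightarrow> 'v set \<Rightarrow> 'v set"
  where "bracket_span A B = span {bracket x y | x y. x \<in> A \<and> y \<in> B}"

definition perfect :: bool
  where "perfect \<longleftrightarrow> bracket_span UNIV UNIV = UNIV"

definition lie_ideal :: "'v set \<Rightarrow> bool"
  where "lie_ideal I \<longleftrightarrow> subspace I \<and> (\<forall>x. \<forall>y\<in>I. bracket x y \<in> I)"

primrec derived_series :: "'v set \<Rightarrow> nat \<Rightarrow> 'v set"
  where
    "derived_series A 0 = A"
  | "derived_series A (Suc k) = bracket_span (derived_series A k) (derived_series A k)"

definition solvable :: "'v set \<Rightarrow> bool"
  where "solvable A \<longleftrightarrow> (\<exists>k. derived_series A k = {0})"

text \<open>The sum of all solvable ideals; in finite dimension this is the largest solvable ideal.\<close>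

definition radical :: "'v set"
  where "radical = span (\<Union>{I. lie_ideal I \<and> solvable I})"

definition semisimple :: bool
  where "semisimple \<longleftrightarrow> radical = {0}"

end

text \<open>Each Lie algebra is given by its scalar multiplication, its carrier (a subspace of the
  underlying type) and its bracket.\<close>

definition lie_isomorphic ::
    "('a::field \<Rightarrow> 'v::ab_group_add \<Rightarrow> 'v) \<Rightarrow> 'v set \<Rightarrow> ('v \<Rightarrow> 'v \<Rightarrow> 'v) \<Rightarrow>
     ('a \<Rightarrow> 'w::ab_group_add \<Rightarrow> 'w) \<Rightarrow> 'w set \<Rightarrow> ('w \<Rightarrow> 'w \<Rightarrow> 'w) \<Rightarrow> bool"
  where "lie_isomorphic s1 L1 br1 s2 L2 br2 \<longleftrightarrow>
    (\<exists>f. bij_betw f L1 L2 \<and>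
         (\<forall>x\<in>L1. \<forall>y\<in>L1. f (x + y) = f x + f y) \<and>
         (\<forall>c. \<forall>x\<in>L1. f (s1 c x) = s2 c (f x)) \<and>
         (\<forall>x\<in>L1. \<forall>y\<in>L1. f (br1 x y) = br2 (f x) (f y)))"

text \<open>The library's scalar multiplications on matrices are either real or do not act entrywise
  by elements of the field of entries.\<close>

definition matrix_scale :: "'a::field \<Rightarrow> 'a^'n^'m \<Rightarrow> 'a^'n^'m"
  where "matrix_scale c A = (\<chi> i j. c * A $ i $ j)"

definition commutator :: "'a::field^'n^'n \<Rightarrow> 'a^'n^'n \<Rightarrow> 'a^'n^'n"
  where "commutator A B = A ** B - B ** A"

definition sl :: "('a::field^'n^'n) set"
  where "sl = {A. trace A = 0}"

lemma vector_space_matrix_scale: "vector_space matrix_scale"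
  by unfold_locales (auto simp: matrix_scale_def vec_eq_iff algebra_simps)

lemma matrix_mult_scale:
  fixes A B :: "'a::field^'n^'n"
  shows "matrix_scale c A ** B = matrix_scale c (A ** B)"
    and "A ** matrix_scale c B = matrix_scale c (A ** B)"
  by (simp_all add: matrix_scale_def matrix_matrix_mult_def vec_eq_iff sum_distrib_left mult_ac)

lemma lie_algebra_gl: "lie_algebra matrix_scale (commutator :: 'a::field^'n^'n \<Rightarrow> _)"
proof -
  interpret M: vector_space "matrix_scale :: 'a \<Rightarrow> 'a^'n^'n \<Rightarrow> _"
    by (rule vector_space_matrix_scale)
  have add: "(A + B) ** C = A ** C + B ** C" "C ** (A + B) = C ** A + C ** B"
    for A B C :: "'a^'n^'n"
    by (simp_all add: matrix_matrix_mult_def vec_eq_iff sum.distrib algebra_simps)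
  have minus: "(A - B) ** C = A ** C - B ** C" "C ** (A - B) = C ** A - C ** B"
    for A B C :: "'a^'n^'n"
    by (simp_all add: matrix_matrix_mult_def vec_eq_iff sum_subtractf algebra_simps)
  show ?thesis
  proof
    show "bilinear_over matrix_scale (commutator :: 'a^'n^'n \<Rightarrow> _)"
      unfolding bilinear_over_def
      by (intro conjI allI; unfold_locales)
        (simp_all add: commutator_def add matrix_mult_scale
          M.scale_right_diff_distrib)
  next
    fix A B C :: "'a^'n^'n"
    show "commutator A A = 0"
      by (simp add: commutator_def)
    show "commutator A (commutator B C) + commutator B (commutator C A)
        + commutator C (commutator A B) = 0"
      by (simp add: commutator_def minus matrix_mul_assoc)
  qed
qed

lemma subspace_sl: "module.subspace matrix_scale (sl :: ('a::field^'n^'n) set)"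
proof -
  interpret M: vector_space "matrix_scale :: 'a \<Rightarrow> 'a^'n^'n \<Rightarrow> _"
    by (rule vector_space_matrix_scale)
  show ?thesis
    by (auto simp: M.subspace_def sl_def trace_def matrix_scale_def sum.distrib
        simp flip: sum_distrib_left)
qed

lemma commutator_in_sl: "commutator A B \<in> sl"
  by (simp add: sl_def commutator_def trace_sub trace_mul_sym[of A B])

definition PA_structure ::
    "('a::field \<Rightarrow> 'v::ab_group_add \<Rightarrow> 'v) \<Rightarrow> ('v \<Rightarrow> 'v \<Rightarrow> 'v) \<Rightarrow> ('v \<Rightarrow> 'v \<Rightarrow> 'v) \<Rightarrow>
     ('v \<Rightarrow> 'v \<Rightarrow> 'v) \<Rightarrow> bool"
  where "PA_structure smul g n p \<longleftrightarrow>
    bilinear_over smul p \<and>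
    (\<forall>x y. p x y - p y x = g x y - n x y) \<and>
    (\<forall>x y z. p (g x y) z = p x (p y z) - p y (p x z)) \<and>
    (\<forall>x y z. p x (n y z) = n (p x y) z + n y (p x z))"

end

theory Submission
  imports Defs "HOL-Computational_Algebra.Fundamental_Theorem_Algebra"
begin

text \<open>
  Identify \<open>n\<close> with \<open>sl\<^sub>3\<close> by an isomorphism \<open>f\<close>. By the third axiom left multiplications are
  derivations of \<open>n\<close>, hence inner, so \<open>f(x \<cdot> y) = [F x, f y]\<close> for a linear map \<open>F\<close> into \<open>sl\<^sub>3\<close>. The
  other axioms then say precisely that \<open>F\<close> and \<open>H = F + f\<close> are Lie algebra homomorphisms on \<open>g\<close>
  (\<open>PA_structure_gives_hom_pair\<close>). So the task is to show: if a perfect \<open>g\<close> has two homomorphisms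
  \<open>F\<close>, \<open>H\<close> to \<open>sl\<^sub>3\<close> with bijective difference, then \<open>g\<close> is semisimple. Both images are perfect
  subalgebras of \<open>sl\<^sub>3\<close>, and together they span it.

  If \<open>g\<close> is not semisimple, it has a nonzero abelian ideal \<open>I\<close>, which \<open>F\<close> and \<open>H\<close> cannot both kill;
  say \<open>F(I) \<noteq> 0\<close>. As in the proof of Lie's theorem, a joint weight space of the commuting matrices
  in \<open>F(I)\<close> is invariant under \<open>F(g)\<close>. It is a line or a plane, so, \<open>F(g)\<close> being perfect, \<open>F(g)\<close>
  kills a vector or a covector, and after an automorphism of \<open>sl\<^sub>3\<close> it kills the first basis vector
  (\<open>perfect_with_abelian_normalized_kills_vector\<close>). The stabilizer of that vector is
  \<open>sl\<^sub>2 \<ltimes> \<complex>\<^sup>2\<close>, and a perfect subalgebra of it with a nonzero abelian ideal is everything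
  (\<open>perfect_in_e1_stabilizer_full\<close>).

  Now let \<open>L\<close> be the kernel of \<open>H\<close>. Since \<open>F = -f\<close> on \<open>L\<close>, the image \<open>F(L)\<close> is an ideal of the
  stabilizer isomorphic to \<open>L\<close>, so it is zero, the translations \<open>\<complex>\<^sup>2\<close>, or the whole stabilizer
  (\<open>e1_stabilizer_ideals\<close>). If it is zero, \<open>H\<close> is onto \<open>sl\<^sub>3\<close>, which would have the commuting
  set \<open>H(I)\<close> as a nonzero ideal. If \<open>F(L)\<close> is the whole stabilizer, \<open>H(g)\<close> is a complement of the
  stabilizer and evaluation at the first basis vector maps it bijectively onto \<open>\<complex>\<^sup>3\<close>; this is
  impossible by comparing traces of \<open>ad E\<close>, where \<open>E\<close> fixes that vector
  (\<open>perfect_not_simply_transitive\<close>). If \<open>F(L)\<close> consists of the translations, \<open>H(g)\<close> is a perfect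
  subalgebra of codimension two; its orthogonal complement for the trace form is a two-dimensional
  space normalized by \<open>H(g)\<close>, inside which there is a commuting set that is again normalized, so
  \<open>H(g)\<close> would kill a vector or a covector and have codimension at least three
  (\<open>no_perfect_subalgebra_of_corank_le_2\<close>).
\<close>

section \<open>Abelian ideals\<close>

context lie_algebra
begin

lemma bracket_linear: "Vector_Spaces.linear smul smul (bracket x)"
  "Vector_Spaces.linear smul smul (\<lambda>x. bracket x y)"
  using bilinear by (simp_all add: bilinear_over_def)

lemma bracket_simps:
  "bracket x (y + z) = bracket x y + bracket x z"
  "bracket (x + y) z = bracket x z + bracket y z"
  "bracket x (y - z) = bracket x y - bracket x z"
  "bracket (x - y) z = bracket x z - bracket y z"
  "bracket x (- y) = - bracket x y"
  "bracket (- x) y = - bracket x y"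
  "bracket x (smul c y) = smul c (bracket x y)"
  "bracket (smul c x) y = smul c (bracket x y)"
  "bracket 0 x = 0"
  "bracket x 0 = 0"
proof -
  interpret l: Vector_Spaces.linear smul smul "bracket x" for x by (rule bracket_linear)
  interpret r: Vector_Spaces.linear smul smul "\<lambda>x. bracket x y" for y by (rule bracket_linear)
  show
  "bracket x (y + z) = bracket x y + bracket x z"
  "bracket (x + y) z = bracket x z + bracket y z"
  "bracket x (y - z) = bracket x y - bracket x z"
  "bracket (x - y) z = bracket x z - bracket y z"
  "bracket x (- y) = - bracket x y"
  "bracket (- x) y = - bracket x y"
  "bracket x (smul c y) = smul c (bracket x y)"
  "bracket (smul c x) y = smul c (bracket x y)"
  "bracket 0 x = 0"
  "bracket x 0 = 0"
    by (simp_all add: l.add r.add l.diff r.diff l.neg r.neg l.scale r.scale l.zero r.zero)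
qed

lemma bracket_antisym: "bracket y x = - bracket x y"
proof -
  have "bracket x y + bracket y x = 0"
    using alternating[of "x + y"] unfolding bracket_simps by (simp add: alternating add.commute)
  then show ?thesis
    by (simp add: eq_neg_iff_add_eq_0 add.commute)
qed

text \<open>The Jacobi identity, read as: bracketing with \<open>x\<close> is a derivation.\<close>

lemma ad_derivation: "bracket x (bracket y z) = bracket (bracket x y) z + bracket y (bracket x z)"
proof -
  have "bracket y (bracket z x) = - bracket y (bracket x z)"
    unfolding bracket_antisym[of z x] by (simp only: bracket_simps)
  moreover have "bracket z (bracket x y) = - bracket (bracket x y) z"
    by (rule bracket_antisym)
  ultimately show ?thesis
    using jacobi[of x y z] by (simp add: algebra_simps)
qed

lemma subspace_bracket_span: "subspace (bracket_span A B)"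
  by (simp add: bracket_span_def)

lemma bracket_in_bracket_span: "x \<in> A \<Longrightarrow> y \<in> B \<Longrightarrow> bracket x y \<in> bracket_span A B"
  unfolding bracket_span_def by (intro span_base) blast

lemma lie_ideal_bracket_span:
  assumes "lie_ideal I"
  shows "lie_ideal (bracket_span I I)"
  unfolding lie_ideal_def
proof (intro conjI allI ballI subspace_bracket_span)
  fix x y
  assume "y \<in> bracket_span I I"
  then show "bracket x y \<in> bracket_span I I"
    unfolding bracket_span_def
  proof (induction rule: span_induct_alt)
    case base
    then show ?case by (simp add: bracket_simps span_zero)
  next
    case (step c y z)
    then obtain a b where ab: "a \<in> I" "b \<in> I" "y = bracket a b" by blast
    have "bracket x a \<in> I" "bracket x b \<in> I"
      using assms ab by (auto simp: lie_ideal_def)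
    then have "bracket x y \<in> bracket_span I I"
      unfolding ab(3) ad_derivation[of x a b]
      by (intro subspace_add[OF subspace_bracket_span] bracket_in_bracket_span ab)
    with step.IH show ?case
      by (simp add: bracket_simps span_add span_scale bracket_span_def)
  qed
qed

lemma lie_ideal_derived_series: "lie_ideal I \<Longrightarrow> lie_ideal (derived_series I k)"
  by (induction k) (simp_all add: lie_ideal_bracket_span)

text \<open>A nonzero radical contains a nonzero solvable ideal. All terms of its derived series are
  ideals, and the last nonzero one is abelian.\<close>

lemma abelian_ideal_if_not_semisimple:
  assumes "\<not> semisimple"
  obtains I where "lie_ideal I" "I \<noteq> {0}" "\<And>x y. x \<in> I \<Longrightarrow> y \<in> I \<Longrightarrow> bracket x y = 0"
proof -
  have "\<exists>I. lie_ideal I \<and> solvable I \<and> I \<noteq> {0}"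
  proof (rule ccontr)
    assume "\<not> ?thesis"
    then have "\<Union>{I. lie_ideal I \<and> solvable I} \<subseteq> {0}" by auto
    then have "radical \<subseteq> span {0}"
      unfolding radical_def by (rule span_mono)
    moreover have "0 \<in> radical"
      by (simp add: radical_def span_zero)
    ultimately show False
      using assms by (auto simp: semisimple_def)
  qed
  then obtain J where J: "lie_ideal J" "solvable J" "J \<noteq> {0}" by blast
  define k where "k = (LEAST k. derived_series J k = {0})"
  have k: "derived_series J k = {0}"
    using J(2) unfolding solvable_def k_def by (rule LeastI_ex)
  have least: "derived_series J j \<noteq> {0}" if "j < k" for j
    using that not_less_Least unfolding k_def by blast
  from k J(3) obtain j where j: "k = Suc j"
    by (cases k) auto
  show ?thesis
  proof
    show "lie_ideal (derived_series J j)" "derived_series J j \<noteq> {0}"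
      using J(1) least[of j] j by (simp_all add: lie_ideal_derived_series)
    show "bracket x y = 0" if "x \<in> derived_series J j" "y \<in> derived_series J j" for x y
      using bracket_in_bracket_span[OF that] k j by simp
  qed
qed

end

section \<open>Linear functionals and coranks\<close>

lemma linear_functional_vanishing_on_subspace:
  fixes smul :: "'a::field \<Rightarrow> 'v::ab_group_add \<Rightarrow> 'v"
  assumes "vector_space smul" "module.subspace smul S" "x \<notin> S"
  obtains l where "Vector_Spaces.linear smul (*) l" "l x = 1" "\<And>s. s \<in> S \<Longrightarrow> l s = 0"
proof -
  interpret vector_space smul by fact
  interpret vector_space_pair smul "(*) :: 'a \<Rightarrow> 'a \<Rightarrow> 'a" by unfold_locales
  obtain B where B: "B \<subseteq> S" "independent B" "S \<subseteq> span B"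
    using maximal_independent_subset by blast
  then have "span B \<subseteq> S"
    using assms(2) by (simp add: span_minimal)
  with B assms(3) have x: "x \<notin> span B" by auto
  then have "independent (insert x B)"
    using B(2) by (simp add: independent_insertI)
  then obtain l where l: "Vector_Spaces.linear smul (*) l"
    "\<And>v. v \<in> insert x B \<Longrightarrow> l v = (if v = x then 1 else 0)"
    using linear_independent_extend[of "insert x B" "\<lambda>v. if v = x then 1 else 0"] by metis
  interpret l: Vector_Spaces.linear smul "(*)" l by (rule l)
  have "l s = 0" if "s \<in> S" for s
  proof -
    have "s \<in> span B" using that B(3) by auto
    then show ?thesis
    proof (rule l.eq_0_on_span[rotated])
      fix v assume "v \<in> B"
      moreover from this have "v \<noteq> x" using x span_base by auto
      ultimately show "l v = 0" using l(2) by simp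
    qed
  qed
  with l show ?thesis by (intro that[of l]) auto
qed

text \<open>Adding a rank one map \<open>x \<mapsto> c x \<cdot> y\<close> to \<open>T\<close> removes one dimension from the kernel: choose
  \<open>y\<close> outside the range of \<open>T\<close>, so that the correction cannot cancel \<open>T x\<close> unless both vanish, and
  \<open>c\<close> nonzero on the kernel vector that is to disappear. Applied twice this bounds the corank of
  an endomorphism by the dimension of its kernel, in the explicit form used later.\<close>

lemma (in finite_dimensional_vector_space) rank_one_correction:
  assumes T: "Vector_Spaces.linear scale scale T"
    and ker: "{x. T x = 0} \<subseteq> span (insert l S)"
  obtains c y T' where "Vector_Spaces.linear scale scale T'" "\<And>x. T' x = T x + scale (c x) y"
    "{x. T' x = 0} \<subseteq> span S"
proof -
  interpret T: Vector_Spaces.linear scale scale T by (rule T)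
  show ?thesis
  proof (cases "l \<in> span S \<or> surj T")
    case True
    (* Either l is redundant, or T is surjective and hence injective: no correction is needed. *)
    have "{x. T x = 0} \<subseteq> span S"
    proof (cases "surj T")
      case True
      then have "inj T" using linear_surj_imp_inj[OF T] by blast
      then have "{x. T x = 0} \<subseteq> {0}" by (metis (mono_tags) T.zero injD mem_Collect_eq singleton_iff subsetI)
      then show ?thesis using span_zero by auto
    next
      case False
      with \<open>l \<in> span S \<or> surj T\<close> ker show ?thesis by (simp add: span_redundant)
    qed
    with T show ?thesis by (intro that[of T "\<lambda>_. 0" 0]) auto
  next
    case False
    then obtain y where y: "y \<notin> range T" by auto
    obtain c where c: "Vector_Spaces.linear scale (*) c" "c l = 1" "\<And>s. s \<in> span S \<Longrightarrow> c s = 0"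
      using linear_functional_vanishing_on_subspace[OF vector_space_axioms subspace_span, of l S] False
      by blast
    interpret c: Vector_Spaces.linear scale "(*)" c by (rule c)
    define T' where "T' x = T x + scale (c x) y" for x
    have "x \<in> span S" if x: "T' x = 0" for x
    proof -
      have cx: "c x = 0"
      proof (rule ccontr)
        assume "c x \<noteq> 0"
        then have "y = T (scale (- inverse (c x)) x)"
          using x scale_left_imp_eq[of "c x"]
          by (simp add: T'_def T.scale T.neg add_eq_0_iff2)
        with y show False by blast
      qed
      with x have "T x = 0" by (simp add: T'_def)
      then obtain k where k: "x - scale k l \<in> span S"
        using ker span_breakdown_eq by blast
      have "c (x - scale k l) = 0" by (rule c(3)) (rule k)
      then have "k = 0" using cx c(2) by (simp add: c.diff c.scale)
      with k show ?thesis by simp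
    qed
    moreover have "Vector_Spaces.linear scale scale T'"
      by unfold_locales (simp_all add: T'_def T.add T.scale c.add c.scale algebra_simps scale_left_distrib scale_right_distrib)
    ultimately show ?thesis using T'_def by (intro that[of T' c y]) auto
  qed
qed

lemma (in finite_dimensional_vector_space) corank_le_2:
  assumes T: "Vector_Spaces.linear scale scale T"
    and ker: "{x. T x = 0} \<subseteq> span {l1, l2}"
  obtains y1 y2 where "\<And>v. \<exists>x a b. v = T x + scale a y1 + scale b y2"
proof -
  obtain c y1 T' where 1: "Vector_Spaces.linear scale scale T'"
    "\<And>x. T' x = T x + scale (c x) y1" "{x. T' x = 0} \<subseteq> span {l2}"
    using rank_one_correction[OF assms] by metis
  obtain d y2 T'' where 2: "Vector_Spaces.linear scale scale T''"
    "\<And>x. T'' x = T' x + scale (d x) y2" "{x. T'' x = 0} \<subseteq> span {}"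
    using rank_one_correction[OF 1(1,3)] by metis
  interpret T'': Vector_Spaces.linear scale scale T'' by (rule 2)
  have "inj T''"
    using 2(3) by (auto simp: T''.inj_iff_eq_0)
  then have "surj T''"
    using linear_inj_imp_surj[OF 2(1)] by blast
  then have "\<exists>x a b. v = T x + scale a y1 + scale b y2" for v
    by (metis 1(2) 2(2) surjD)
  then show ?thesis using that by blast
qed

section \<open>Derivations of the Lie algebra of all matrices\<close>

interpretation gl: lie_algebra "matrix_scale :: 'a::field \<Rightarrow> 'a^'n^'n \<Rightarrow> _" commutator
  by (rule lie_algebra_gl)

lemma trace_matrix_scale: "trace (matrix_scale c (A :: 'a::field^'n^'n)) = c * trace A"
  by (simp add: trace_def matrix_scale_def sum_distrib_left)

lemma commutator_antisym: "commutator A B = - commutator B A"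
  by (simp add: commutator_def)

definition matrix_unit :: "'n \<Rightarrow> 'n \<Rightarrow> 'a::field^'n^'n"
  where "matrix_unit i j = (\<chi> a b. if a = i \<and> b = j then 1 else 0)"

lemma matrix_unit_mult:
  fixes A :: "'a::field^'n^'n"
  shows "(matrix_unit i j ** A) $ a $ b = (if a = i then A $ j $ b else 0)"
    and "(A ** matrix_unit i j) $ a $ b = (if b = j then A $ a $ i else 0)"
  by (auto simp: matrix_unit_def matrix_matrix_mult_def if_distrib if_distribR cong: if_cong)

lemma commutator_matrix_unit:
  fixes X :: "'a::field^'n^'n"
  shows "commutator X (matrix_unit i j) =
    (\<Sum>k\<in>UNIV. matrix_scale (X $ k $ i) (matrix_unit k j) - matrix_scale (X $ j $ k) (matrix_unit i k))"
proof -
  have 1: "(\<Sum>k\<in>UNIV. X $ k $ i * matrix_unit k j $ a $ b) = (if b = j then X $ a $ i else 0)" for a b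
    by (cases "b = j") (simp_all add: matrix_unit_def if_distrib[of "(*) _"] cong: if_cong)
  have 2: "(\<Sum>k\<in>UNIV. X $ j $ k * matrix_unit i k $ a $ b) = (if a = i then X $ j $ b else 0)" for a b
    by (cases "a = i") (simp_all add: matrix_unit_def if_distrib[of "(*) _"] cong: if_cong)
  show ?thesis
    by (simp add: vec_eq_iff commutator_def matrix_unit_mult sum_subtractf matrix_scale_def 1 2)
qed

text \<open>The matrix units \<open>E\<^sub>i\<^sub>j\<close> and \<open>E\<^sub>j\<^sub>i\<close> form dual bases for the trace form, so the tensor
  \<open>\<Sum> E\<^sub>i\<^sub>j \<otimes> E\<^sub>j\<^sub>i\<close> is invariant under the adjoint action. Here it is contracted with an arbitrary
  bilinear map, which expresses the invariance without tensor products.\<close>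

lemma sum_matrix_unit_commutator_invariant:
  fixes \<beta> :: "'a::field^'n^'n \<Rightarrow> 'a^'n^'n \<Rightarrow> 'a^'n^'n"
  assumes "bilinear_over matrix_scale \<beta>"
  shows "(\<Sum>i\<in>UNIV. \<Sum>j\<in>UNIV. \<beta> (commutator X (matrix_unit i j)) (matrix_unit j i)
    + \<beta> (matrix_unit i j) (commutator X (matrix_unit j i))) = 0"
proof -
  have l: "Vector_Spaces.linear matrix_scale matrix_scale (\<beta> A)"
    and r: "Vector_Spaces.linear matrix_scale matrix_scale (\<lambda>A. \<beta> A B)" for A B
    using assms by (auto simp: bilinear_over_def)
  interpret l: Vector_Spaces.linear matrix_scale matrix_scale "\<beta> A" for A by (rule l)
  interpret r: Vector_Spaces.linear matrix_scale matrix_scale "\<lambda>A. \<beta> A B" for B by (rule r)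
  let ?E = matrix_unit
  let ?p = "\<lambda>i j k. matrix_scale (X $ k $ i) (\<beta> (?E k j) (?E j i))"
  let ?q = "\<lambda>i j k. matrix_scale (X $ j $ k) (\<beta> (?E i k) (?E j i))"
  have 1: "\<beta> (commutator X (?E i j)) (?E j i) = (\<Sum>k\<in>UNIV. ?p i j k) - (\<Sum>k\<in>UNIV. ?q i j k)" for i j
    by (simp add: commutator_matrix_unit r.sum r.diff r.scale sum_subtractf)
  have 2: "\<beta> (?E i j) (commutator X (?E j i)) = (\<Sum>k\<in>UNIV. ?q i k j) - (\<Sum>k\<in>UNIV. ?p k j i)" for i j
    by (simp add: commutator_matrix_unit l.sum l.diff l.scale sum_subtractf)
  have "(\<Sum>i\<in>UNIV. \<Sum>j\<in>UNIV. \<Sum>k\<in>UNIV. ?q i k j) = (\<Sum>i\<in>UNIV. \<Sum>j\<in>UNIV. \<Sum>k\<in>UNIV. ?q i j k)"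
    by (intro sum.cong refl sum.swap)
  moreover have "(\<Sum>i\<in>UNIV. \<Sum>j\<in>UNIV. \<Sum>k\<in>UNIV. ?p k j i) = (\<Sum>i\<in>UNIV. \<Sum>j\<in>UNIV. \<Sum>k\<in>UNIV. ?p i j k)"
  proof -
    have "(\<Sum>i\<in>UNIV. \<Sum>j\<in>UNIV. \<Sum>k\<in>UNIV. ?p k j i) = (\<Sum>j\<in>UNIV. \<Sum>i\<in>UNIV. \<Sum>k\<in>UNIV. ?p k j i)"
      by (rule sum.swap)
    also have "\<dots> = (\<Sum>j\<in>UNIV. \<Sum>i\<in>UNIV. \<Sum>k\<in>UNIV. ?p i j k)"
      by (intro sum.cong refl sum.swap)
    also have "\<dots> = (\<Sum>i\<in>UNIV. \<Sum>j\<in>UNIV. \<Sum>k\<in>UNIV. ?p i j k)"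
      by (rule sum.swap)
    finally show ?thesis .
  qed
  ultimately show ?thesis
    unfolding 1 2 by (simp add: sum.distrib sum_subtractf)
qed

text \<open>The Casimir operator of the adjoint representation: it acts by the scalar \<open>2n\<close> on traceless
  matrices.\<close>

lemma gl_casimir:
  fixes Y :: "'a::field^'n^'n"
  shows "(\<Sum>i\<in>UNIV. \<Sum>j\<in>UNIV. commutator (commutator Y (matrix_unit i j)) (matrix_unit j i))
    = matrix_scale (2 * of_nat CARD('n)) Y - matrix_scale (2 * trace Y) (mat 1)"
proof -
  have "(\<Sum>i\<in>UNIV. \<Sum>j\<in>UNIV. commutator (commutator Y (matrix_unit i j)) (matrix_unit j i) $ a $ b)
    = 2 * of_nat CARD('n) * Y $ a $ b - (if a = b then 2 * trace Y else 0)" for a b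
  proof -
    have eq: "commutator (commutator Y (matrix_unit i j)) (matrix_unit j i) $ a $ b =
      (if b = i then Y $ a $ i else 0) - (if a = i then if b = i then Y $ j $ j else 0 else 0)
      - (if a = j then if b = j then Y $ i $ i else 0 else 0) + (if a = j then Y $ j $ b else 0)" for i j
      by (auto simp: commutator_def matrix_unit_mult)
    have 1: "(\<Sum>i\<in>UNIV. \<Sum>j\<in>(UNIV::'n set). if b = i then Y $ a $ i else 0)
        = of_nat CARD('n) * Y $ a $ b"
      by (simp add: sum_distrib_left[symmetric])
    have 2: "(\<Sum>i\<in>UNIV. \<Sum>j\<in>UNIV. if a = i then if b = i then Y $ j $ j else 0 else 0)
        = (if a = b then trace Y else 0)"
    proof -
      have "(\<Sum>j\<in>UNIV. if a = i then if b = i then Y $ j $ j else 0 else 0)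
          = (if a = i then if b = i then trace Y else 0 else 0)" for i
        by (simp add: trace_def)
      then show ?thesis by simp
    qed
    have 3: "(\<Sum>i\<in>UNIV. \<Sum>j\<in>UNIV. if a = j then if b = j then Y $ i $ i else 0 else 0)
        = (if a = b then trace Y else 0)"
      by (simp add: trace_def)
    have 4: "(\<Sum>i\<in>(UNIV::'n set). \<Sum>j\<in>UNIV. if a = j then Y $ j $ b else 0)
        = of_nat CARD('n) * Y $ a $ b"
      by simp
    show ?thesis
      unfolding sum_component eq sum.distrib sum_subtractf 1 2 3 4 by simp
  qed
  then show ?thesis
    by (simp add: vec_eq_iff matrix_scale_def mat_def)
qed

text \<open>Whitehead's averaging argument in degree one. Applying \<open>ad X\<close> to \<open>M = \<Sum> [D E\<^sub>i\<^sub>j, E\<^sub>j\<^sub>i]\<close> and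
  using that \<open>D\<close> is a derivation, all terms cancel by invariance of the tensor above except the
  Casimir operator applied to \<open>D X\<close>; hence \<open>2n D = ad M\<close>.\<close>

theorem derivation_of_gl_inner:
  fixes D :: "'a::field^'n^'n \<Rightarrow> 'a^'n^'n"
  assumes lin: "Vector_Spaces.linear matrix_scale matrix_scale D"
    and der: "\<And>A B. D (commutator A B) = commutator (D A) B + commutator A (D B)"
    and tr: "\<And>A. trace (D A) = 0"
  shows "commutator (\<Sum>i\<in>UNIV. \<Sum>j\<in>UNIV. commutator (D (matrix_unit i j)) (matrix_unit j i)) X
    = matrix_scale (2 * of_nat CARD('n)) (D X)"
    (is "commutator ?M X = _")
proof -
  interpret D: Vector_Spaces.linear matrix_scale matrix_scale D by (rule lin)
  interpret ad: Vector_Spaces.linear matrix_scale matrix_scale "commutator A" for A :: "'a^'n^'n"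
    by (rule gl.bracket_linear)
  let ?E = "matrix_unit :: 'n \<Rightarrow> 'n \<Rightarrow> 'a^'n^'n"
  have "bilinear_over matrix_scale (\<lambda>A B. commutator (D A) B)"
    unfolding bilinear_over_def
    by (intro conjI allI gl.bracket_linear; unfold_locales)
      (simp_all add: D.add D.scale gl.bracket_simps)
  note inv = sum_matrix_unit_commutator_invariant[OF this, of X]
  have "commutator X ?M = (\<Sum>i\<in>UNIV. \<Sum>j\<in>UNIV. commutator X (commutator (D (?E i j)) (?E j i)))"
    by (simp add: ad.sum)
  also have "\<dots> = (\<Sum>i\<in>UNIV. \<Sum>j\<in>UNIV.
      (commutator (D (commutator X (?E i j))) (?E j i) + commutator (D (?E i j)) (commutator X (?E j i)))
      - commutator (commutator (D X) (?E i j)) (?E j i))"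
    by (intro sum.cong refl) (simp add: der gl.ad_derivation[of X] gl.bracket_simps algebra_simps)
  also have "\<dots> = - (\<Sum>i\<in>UNIV. \<Sum>j\<in>UNIV. commutator (commutator (D X) (?E i j)) (?E j i))"
    using inv by (simp add: sum_subtractf)
  also have "\<dots> = - matrix_scale (2 * of_nat CARD('n)) (D X)"
    by (simp add: gl_casimir tr)
  finally show ?thesis
    using commutator_antisym[of ?M X] by simp
qed

section \<open>Invariant subspaces from commuting matrices of size three\<close>

lemma matrix_vector_scale: "matrix_scale c A *v v = c *s (A *v (v :: 'a::field^'n))"
  by (simp add: matrix_scale_def matrix_vector_mult_def vec_eq_iff sum_distrib_left mult_ac)

lemma matrix_diff_distrib:
  fixes A B C :: "'a::field^'n^'n"
  shows "(A - B) ** C = A ** C - B ** C" "C ** (A - B) = C ** A - C ** B"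
  by (simp_all add: matrix_matrix_mult_def vec_eq_iff sum_subtractf algebra_simps)

lemma trace_scalar_matrix: "trace (matrix_scale c (mat 1 :: 'a::field^'n^'n)) = of_nat CARD('n) * c"
  by (simp add: trace_def matrix_scale_def mat_def)

text \<open>The coefficients are the characteristic ones; only the relation of \<open>s\<close> to power traces is
  recorded, since the determinant is recovered by taking traces.\<close>

lemma cayley_hamilton_3:
  fixes A :: "'a::field^3^3"
  obtains s d where "A ** (A ** A) = matrix_scale (trace A) (A ** A) - matrix_scale s A + matrix_scale d (mat 1)"
    and "2 * s = (trace A)\<^sup>2 - trace (A ** A)"
proof
  let ?s = "A$1$1 * A$2$2 - A$1$2 * A$2$1 + A$1$1 * A$3$3 - A$1$3 * A$3$1 + A$2$2 * A$3$3 - A$2$3 * A$3$2"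
  show "A ** (A ** A) = matrix_scale (trace A) (A ** A) - matrix_scale ?s A + matrix_scale (det A) (mat 1)"
    by (simp add: vec_eq_iff forall_3 matrix_scale_def matrix_matrix_mult_def sum_3 trace_def det_3 mat_def
      algebra_simps)
  show "2 * ?s = (trace A)\<^sup>2 - trace (A ** A)"
    by (simp add: matrix_matrix_mult_def sum_3 trace_def power2_eq_square algebra_simps)
qed

lemma cubic_roots:
  fixes t s d :: complex
  obtains a b c where "a + b + c = t" "a * b + b * c + c * a = s" "a * b * c = d"
proof -
  have root: "\<exists>z. poly p z = 0" if "degree p > 0" for p :: "complex poly"
    using fundamental_theorem_of_algebra[of p] that
    by (simp add: constant_degree)
  obtain a where a: "poly [:- d, s, - t, 1:] a = 0"
    using root[of "[:- d, s, - t, 1:]"] by auto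
  obtain b where b: "poly [:s - a * (t - a), - (t - a), 1:] b = 0"
    using root[of "[:s - a * (t - a), - (t - a), 1:]"] by auto
  show ?thesis
  proof
    show "a + b + (t - a - b) = t" by simp
    show s: "a * b + b * (t - a - b) + (t - a - b) * a = s"
      using b by (simp add: algebra_simps) 
    show "a * b * (t - a - b) = d"
      using a b by (simp add: algebra_simps) algebra
  qed
qed

text \<open>The characteristic polynomial splits, so \<open>(A - a)(A - b)(A - c) = 0\<close>. Applying the factors one
  after the other to a nonzero vector of \<open>W\<close>, the last vector before \<open>0\<close> is an eigenvector, and it
  lies in \<open>W\<close>.\<close>

lemma eigenvector_in_invariant_subspace:
  fixes A :: "complex^3^3"
  assumes W: "vec.subspace W" "W \<noteq> {0}" and inv: "\<And>w. w \<in> W \<Longrightarrow> A *v w \<in> W"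
  obtains w \<mu> where "w \<in> W" "w \<noteq> 0" "A *v w = \<mu> *s w"
proof -
  obtain s d where ch: "A ** (A ** A) = matrix_scale (trace A) (A ** A) - matrix_scale s A + matrix_scale d (mat 1)"
    using cayley_hamilton_3 by metis
  obtain a b c where abc: "a + b + c = trace A" "a * b + b * c + c * a = s" "a * b * c = d"
    using cubic_roots by metis
  define p where "p z w = A *v w - z *s w" for z w
  have p: "p z w \<in> W" if "w \<in> W" for z w
    unfolding p_def using W(1) inv that by (simp add: vec.subspace_diff vec.subspace_scale)
  have zero: "p a (p b (p c w)) = 0" for w
  proof -
    have "p a (p b (p c w)) = A *v (A *v (A *v w)) - (a + b + c) *s (A *v (A *v w))
        + (a * b + b * c + c * a) *s (A *v w) - (a * b * c) *s w"
      by (simp add: p_def matrix_vector_mult_diff_distrib vec.scale vec.scale_right_diff_distrib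
          vec.scale_left_distrib algebra_simps)
    also have "A *v (A *v (A *v w)) = (A ** (A ** A)) *v w"
      by (simp add: matrix_vector_mul_assoc)
    finally show ?thesis
      unfolding ch abc
      by (simp add: matrix_vector_mult_add_rdistrib matrix_vector_mult_diff_rdistrib matrix_vector_scale
          matrix_vector_mul_assoc)
  qed
  obtain w where w: "w \<in> W" "w \<noteq> 0"
    using W vec.subspace_0 by blast
  have "p c w = 0 \<or> p b (p c w) = 0 \<or> p a (p b (p c w)) = 0"
    using zero by blast
  then obtain z u where "u \<in> W" "u \<noteq> 0" "p z u = 0"
    using w p by metis
  then show ?thesis
    using that by (simp add: p_def)
qed

text \<open>On a nonzero invariant subspace of minimal dimension every element of a commuting family is
  scalar, because its eigenspaces there are invariant under the whole family.\<close>

lemma joint_eigenvector: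
  fixes R :: "(complex^3^3) set"
  assumes comm: "\<And>X Y. X \<in> R \<Longrightarrow> Y \<in> R \<Longrightarrow> X ** Y = Y ** X"
  obtains w where "w \<noteq> 0" "\<And>X. X \<in> R \<Longrightarrow> \<exists>\<mu>. X *v w = \<mu> *s w"
proof -
  define good where "good W \<longleftrightarrow> vec.subspace W \<and> W \<noteq> {0} \<and> (\<forall>X\<in>R. \<forall>w\<in>W. X *v w \<in> W)"
    for W :: "(complex^3) set"
  have "(1 :: complex^3) \<noteq> 0" by (simp add: vec_eq_iff)
  then have "good UNIV"
    unfolding good_def by (auto simp: vec.subspace_UNIV)
  then obtain W where W: "good W" "\<And>U. good U \<Longrightarrow> vec.dim W \<le> vec.dim U"
    using ex_has_least_nat[of good UNIV vec.dim] by blast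
  have scalar: "\<exists>\<mu>. \<forall>w\<in>W. X *v w = \<mu> *s w" if X: "X \<in> R" for X
  proof -
    obtain w \<mu> where w: "w \<in> W" "w \<noteq> 0" "X *v w = \<mu> *s w"
      using eigenvector_in_invariant_subspace[of W X] W(1) X unfolding good_def by metis
    define U where "U = {u \<in> W. X *v u = \<mu> *s u}"
    have sub: "vec.subspace U"
      using W(1) unfolding good_def U_def vec.subspace_def
      by (auto simp: matrix_vector_right_distrib vec.scale vector_add_ldistrib mult.commute)
    have "Y *v u \<in> U" if "Y \<in> R" "u \<in> U" for Y u
    proof -
      have "X *v (Y *v u) = Y *v (X *v u)"
        using comm[OF X \<open>Y \<in> R\<close>] by (simp add: matrix_vector_mul_assoc)
      then show ?thesis
        using that W(1) by (auto simp: U_def good_def vec.scale)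
    qed
    moreover have "U \<noteq> {0}" using w by (auto simp: U_def)
    ultimately have "good U" using sub by (simp add: good_def)
    then have "U = W"
      using W(2)[of U] vec.subspace_dim_equal[of U W] sub W(1) by (auto simp: U_def good_def)
    then show ?thesis by (auto simp: U_def)
  qed
  obtain w where "w \<in> W" "w \<noteq> 0"
    using W(1) vec.subspace_0 unfolding good_def by blast
  with scalar show ?thesis
    by (intro that[of w]) blast+
qed

text \<open>Jacobson's lemma: \<open>Y = [B, X]\<close> is orthogonal, for the trace form, to everything that commutes
  with \<open>X\<close>, in particular to \<open>1\<close>, \<open>Y\<close> and \<open>Y\<^sup>2\<close>. So the power traces of \<open>Y\<close> vanish, and with them the
  lower coefficients of its characteristic polynomial.\<close>

lemma commutator_commuting_nilpotent_3:
  fixes B X :: "'a::field_char_0^3^3"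
  assumes "commutator B X ** X = X ** commutator B X"
  defines "Y \<equiv> commutator B X"
  shows "Y ** (Y ** Y) = 0"
proof -
  have tr: "trace (Z ** Y) = 0" if "Z ** X = X ** Z" for Z
  proof -
    have "trace (Z ** Y) = trace (Z ** (B ** X)) - trace (Z ** X ** B)"
      by (simp add: Y_def commutator_def matrix_diff_distrib trace_sub matrix_mul_assoc)
    also have "trace (Z ** X ** B) = trace (X ** (Z ** B))"
      by (simp add: that matrix_mul_assoc)
    also have "\<dots> = trace (Z ** (B ** X))"
      by (subst trace_mul_sym) (simp add: matrix_mul_assoc)
    finally show ?thesis by simp
  qed
  have YX: "Y ** X = X ** Y" using assms by simp
  then have YYX: "(Y ** Y) ** X = X ** (Y ** Y)"
    by (metis matrix_mul_assoc)
  have 1: "trace Y = 0" using tr[of "mat 1"] by simp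
  have 2: "trace (Y ** Y) = 0" using tr[OF YX] .
  have 3: "trace (Y ** (Y ** Y)) = 0" using tr[OF YYX] by (simp add: matrix_mul_assoc)
  obtain s d where ch: "Y ** (Y ** Y) = matrix_scale (trace Y) (Y ** Y) - matrix_scale s Y + matrix_scale d (mat 1)"
    and s: "2 * s = (trace Y)\<^sup>2 - trace (Y ** Y)"
    using cayley_hamilton_3 by metis
  have "s = 0" using s 1 2 by simp
  with ch 1 have eq: "Y ** (Y ** Y) = matrix_scale d (mat 1)" by simp
  then have "d = 0" using 3 by (simp add: trace_scalar_matrix)
  with eq show ?thesis by simp
qed

text \<open>The invariant subspace is a joint weight space \<open>W\<close> of \<open>R\<close> with weight \<open>\<mu>\<close>. For \<open>B \<in> Q\<close> and
  \<open>u \<in> W\<close> we have \<open>X B u = \<mu>(X) B u - \<mu>([B, X]) u\<close>, and \<open>\<mu>([B, X]) = 0\<close> since \<open>[B, X]\<close> is nilpotent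
  by the previous lemma. If \<open>W\<close> were everything, \<open>R\<close> would consist of traceless scalars.\<close>

lemma invariant_subspace_of_abelian_normalized:
  fixes Q R :: "(complex^3^3) set"
  assumes comm: "\<And>X Y. X \<in> R \<Longrightarrow> Y \<in> R \<Longrightarrow> commutator X Y = 0"
    and norm: "\<And>B X. B \<in> Q \<Longrightarrow> X \<in> R \<Longrightarrow> commutator B X \<in> R"
    and tr: "R \<subseteq> sl" and ne: "\<not> R \<subseteq> {0}"
  obtains W where "vec.subspace W" "W \<noteq> {0}" "W \<noteq> UNIV" "\<And>B w. B \<in> Q \<Longrightarrow> w \<in> W \<Longrightarrow> B *v w \<in> W"
proof -
  have comm': "X ** Y = Y ** X" if "X \<in> R" "Y \<in> R" for X Y
    using comm[OF that] by (simp add: commutator_def)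
  obtain w where w: "w \<noteq> 0" "\<And>X. X \<in> R \<Longrightarrow> \<exists>\<mu>. X *v w = \<mu> *s w"
    using joint_eigenvector comm' by metis
  then obtain \<mu> where \<mu>: "\<And>X. X \<in> R \<Longrightarrow> X *v w = \<mu> X *s w" by metis
  define W where "W = {u. \<forall>X\<in>R. X *v u = \<mu> X *s u}"
  show ?thesis
  proof
    show "vec.subspace W"
      unfolding W_def vec.subspace_def
      by (auto simp: matrix_vector_right_distrib vec.scale vector_add_ldistrib mult.commute)
    show "W \<noteq> {0}" using w \<mu> by (auto simp: W_def)
    show "W \<noteq> UNIV"
    proof
      assume "W = UNIV"
      then have W: "X *v u = \<mu> X *s u" if "X \<in> R" for X u
        using that by (auto simp: W_def)
      have "X = 0" if X: "X \<in> R" for X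
      proof -
        have "X *v u = matrix_scale (\<mu> X) (mat 1) *v u" for u
          using W[OF X] by (simp add: matrix_vector_scale)
        then have eq: "X = matrix_scale (\<mu> X) (mat 1)"
          by (simp add: matrix_eq)
        have "trace X = 3 * \<mu> X"
          using arg_cong[OF eq, of trace] by (simp add: trace_scalar_matrix)
        moreover have "trace X = 0" using tr X by (auto simp: sl_def)
        ultimately show ?thesis using eq by simp
      qed
      with ne show False by blast
    qed
    fix B u assume B: "B \<in> Q" and u: "u \<in> W"
    show "B *v u \<in> W"
      unfolding W_def
    proof (intro CollectI ballI)
      fix X assume X: "X \<in> R"
      define Y where "Y = commutator B X"
      have Y: "Y \<in> R" using norm B X by (simp add: Y_def)
      have "Y ** (Y ** Y) = 0"
        unfolding Y_def by (rule commutator_commuting_nilpotent_3) (use comm'[OF Y X] in \<open>simp add: Y_def\<close>)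
      then have "Y *v (Y *v (Y *v w)) = 0"
        by (simp add: matrix_vector_mul_assoc)
      then have "\<mu> Y = 0" using w(1) \<mu>[OF Y] by (simp add: vec.scale)
      then have "Y *v u = 0" using u Y by (simp add: W_def)
      then have "X *v (B *v u) = B *v (X *v u)"
        by (simp add: Y_def commutator_def matrix_vector_mult_diff_rdistrib matrix_vector_mul_assoc)
      then show "X *v (B *v u) = \<mu> X *s (B *v u)"
        using u X by (simp add: W_def vec.scale)
    qed
  qed
qed

section \<open>Perfect Lie algebras of matrices with a killed vector\<close>

lemma matrix_add_rdistrib:
  fixes A B C :: "'a::field^'n^'n"
  shows "(A + B) ** C = A ** C + B ** C"
  by (simp add: matrix_matrix_mult_def vec_eq_iff sum.distrib algebra_simps)

text \<open>Automorphisms are total functions on matrices, so that they compose and apply to subalgebras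
  without restricting domains; only their action on \<open>sl\<close> is required to be bijective.\<close>

definition sl_automorphism :: "('a::field^'n^'n \<Rightarrow> 'a^'n^'n) \<Rightarrow> bool"
  where "sl_automorphism \<theta> \<longleftrightarrow> Vector_Spaces.linear matrix_scale matrix_scale \<theta> \<and>
    (\<forall>A B. \<theta> (commutator A B) = commutator (\<theta> A) (\<theta> B)) \<and> bij_betw \<theta> sl sl"

lemma sl_automorphism_compose:
  "sl_automorphism \<theta> \<Longrightarrow> sl_automorphism \<eta> \<Longrightarrow> sl_automorphism (\<theta> \<circ> \<eta>)"
  unfolding sl_automorphism_def
  by (auto intro: bij_betw_trans Vector_Spaces.linear_compose)

lemma sl_automorphism_conjugation:
  fixes S T :: "'a::field^'n^'n"
  assumes ST: "S ** T = mat 1" "T ** S = mat 1"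
  shows "sl_automorphism (\<lambda>A. T ** A ** S)"
  unfolding sl_automorphism_def
proof (intro conjI allI)
  show "Vector_Spaces.linear matrix_scale matrix_scale (\<lambda>A. T ** A ** S)"
    by unfold_locales (simp_all add: matrix_add_ldistrib matrix_add_rdistrib matrix_mult_scale)
  have mult: "T ** (A ** B) ** S = (T ** A ** S) ** (T ** B ** S)" for A B
  proof -
    have "(T ** A ** S) ** (T ** B ** S) = T ** A ** (S ** T) ** B ** S"
      by (simp only: matrix_mul_assoc)
    then show ?thesis using ST by (simp add: matrix_mul_assoc)
  qed
  show "T ** commutator A B ** S = commutator (T ** A ** S) (T ** B ** S)" for A B
    unfolding commutator_def mult[symmetric] by (simp add: matrix_diff_distrib)
  have inv: "T ** (S ** C ** T) ** S = C" "S ** (T ** C ** S) ** T = C" for C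
    using ST by (metis matrix_mul_assoc matrix_mul_lid matrix_mul_rid)+
  have tr: "trace (T ** C ** S) = trace C" "trace (S ** C ** T) = trace C" for C
    using ST trace_mul_sym[of "T ** C" S] trace_mul_sym[of "S ** C" T] by (simp_all add: matrix_mul_assoc)
  show "bij_betw (\<lambda>A. T ** A ** S) sl sl"
    by (rule bij_betw_byWitness[where f' = "\<lambda>A. S ** A ** T"]) (auto simp: inv tr sl_def)
qed

lemma transpose_linear_simps:
  fixes A B :: "'a::field^'n^'n"
  shows "transpose (A + B) = transpose A + transpose B"
    "transpose (A - B) = transpose A - transpose B"
    "transpose (matrix_scale c A) = matrix_scale c (transpose A)"
    "transpose (- A) = - transpose A"
    "transpose (0 :: 'a^'n^'n) = 0"
  by (simp_all add: transpose_def vec_eq_iff matrix_scale_def)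

lemma commutator_transpose:
  fixes A B :: "'a::field^'n^'n"
  shows "transpose (commutator A B) = - commutator (transpose A) (transpose B)"
  by (simp add: commutator_def matrix_transpose_mul transpose_linear_simps)

text \<open>This outer automorphism exchanges the stabilizers of lines and of planes.\<close>

lemma sl_automorphism_negative_transpose:
  "sl_automorphism (\<lambda>A :: 'a::field^'n^'n. - transpose A)"
  unfolding sl_automorphism_def
proof (intro conjI allI)
  show "Vector_Spaces.linear matrix_scale matrix_scale (\<lambda>A :: 'a::field^'n^'n. - transpose A)"
    by unfold_locales (simp_all add: transpose_linear_simps gl.scale_minus_right)
  show "- transpose (commutator A B) = commutator (- transpose A) (- transpose B)" for A B :: "'a^'n^'n"
    by (simp add: commutator_transpose gl.bracket_simps)
  have tr: "trace (- transpose A) = - trace A" for A :: "'a^'n^'n"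
    by (simp add: trace_def transpose_def sum_negf)
  show "bij_betw (\<lambda>A. - transpose A) sl (sl :: ('a^'n^'n) set)"
    by (rule bij_betw_byWitness[where f' = "\<lambda>A. - transpose A"])
      (auto simp: sl_def tr transpose_linear_simps)
qed

lemma invertible_matrix_with_first_column:
  fixes v :: "'a::field^3"
  assumes "v \<noteq> 0"
  obtains S T :: "'a^3^3" where "S ** T = mat 1" "T ** S = mat 1" "S *v axis 1 1 = v"
proof -
  obtain m where m: "v $ m \<noteq> 0" using assms by (auto simp: vec_eq_iff)
  (* Put v into the first column and complete it by the two unit vectors other than the m-th. *)
  define S1 :: "'a^3^3" where "S1 = (\<chi> i j. if j = 1 then v $ i else if i = j then 1 else 0)"
  define S2 :: "'a^3^3" where "S2 = (\<chi> i j. if j = 1 then v $ i else if j = 2 then (if i = 1 then 1 else 0) else (if i = 3 then 1 else 0))"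
  define S3 :: "'a^3^3" where "S3 = (\<chi> i j. if j = 1 then v $ i else if j = 2 then (if i = 1 then 1 else 0) else (if i = 2 then 1 else 0))"
  have d: "det S1 = v $ 1" "det S2 = - v $ 2" "det S3 = v $ 3"
    by (simp_all add: S1_def S2_def S3_def det_3)
  have c: "S1 *v axis 1 1 = v" "S2 *v axis 1 1 = v" "S3 *v axis 1 1 = v"
    by (simp_all add: S1_def S2_def S3_def vec_eq_iff matrix_vector_mult_def axis_def forall_3 sum_3)
  have "\<exists>S :: 'a^3^3. det S \<noteq> 0 \<and> S *v axis 1 1 = v"
    using exhaust_3[of m] m d c by (metis neg_equal_0_iff_equal)
  then obtain S :: "'a^3^3" where S: "invertible S" "S *v axis 1 1 = v"
    by (auto simp: invertible_det_nz)
  then show ?thesis using that by (auto simp: invertible_def)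
qed

text \<open>On a common eigenvector commutators act as \<open>0\<close>, and a perfect Lie algebra is spanned by
  commutators.\<close>

lemma perfect_matrices_kill_eigenvector:
  fixes Q :: "('a::field^'n^'n) set"
  assumes perf: "Q \<subseteq> gl.bracket_span Q Q"
    and eig: "\<And>B. B \<in> Q \<Longrightarrow> \<exists>c. B *v v = c *s v"
  shows "B \<in> Q \<Longrightarrow> B *v v = 0"
proof -
  let ?K = "{B. B *v v = 0}"
  have "gl.subspace ?K"
    by (auto simp: gl.subspace_def matrix_vector_mult_add_rdistrib matrix_vector_scale)
  moreover have "commutator A B *v v = 0" if "A \<in> Q" "B \<in> Q" for A B
    using eig[OF that(1)] eig[OF that(2)]
    by (auto simp: commutator_def matrix_vector_mult_diff_rdistrib matrix_vector_mul_assoc[symmetric]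
        vec.scale mult.commute)
  ultimately have "gl.bracket_span Q Q \<subseteq> ?K"
    unfolding gl.bracket_span_def by (intro gl.span_minimal) auto
  with perf show "B \<in> Q \<Longrightarrow> B *v v = 0" by blast
qed

lemma perfect_matrices_kill_eigencovector:
  fixes Q :: "('a::field^'n^'n) set"
  assumes perf: "Q \<subseteq> gl.bracket_span Q Q"
    and eig: "\<And>B. B \<in> Q \<Longrightarrow> \<exists>c. transpose B *v v = c *s v"
  shows "B \<in> Q \<Longrightarrow> transpose B *v v = 0"
proof -
  let ?K = "{B. transpose B *v v = 0}"
  have "gl.subspace ?K"
    by (auto simp: gl.subspace_def matrix_vector_mult_add_rdistrib matrix_vector_scale transpose_linear_simps
        simp del: transpose_matrix_vector)
  moreover have "transpose (commutator A B) *v v = 0" if "A \<in> Q" "B \<in> Q" for A B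
    using eig[OF that(1)] eig[OF that(2)]
    by (auto simp: commutator_def transpose_linear_simps matrix_transpose_mul matrix_vector_mult_diff_rdistrib matrix_vector_mul_assoc[symmetric]
        vec.scale mult.commute simp del: transpose_matrix_vector)
  ultimately have "gl.bracket_span Q Q \<subseteq> ?K"
    unfolding gl.bracket_span_def by (intro gl.span_minimal) auto
  with perf show "B \<in> Q \<Longrightarrow> transpose B *v v = 0" by blast
qed

text \<open>An invariant line of \<open>Q\<close> is spanned by a vector killed by \<open>Q\<close>, and an invariant plane is the
  kernel of a covector killed by \<open>Q\<close>. Conjugation, preceded by the negative transpose in the
  second case, turns the killed vector into the first basis vector. In the application \<open>R\<close> is
  the image of an abelian ideal, or is built from the orthogonal complement of \<open>Q\<close>.\<close>

theorem perfect_with_abelian_normalized_kills_vector: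
  fixes Q R :: "(complex^3^3) set"
  assumes perf: "Q \<subseteq> gl.bracket_span Q Q"
    and comm: "\<And>X Y. X \<in> R \<Longrightarrow> Y \<in> R \<Longrightarrow> commutator X Y = 0"
    and norm: "\<And>B X. B \<in> Q \<Longrightarrow> X \<in> R \<Longrightarrow> commutator B X \<in> R"
    and tr: "R \<subseteq> sl" and ne: "\<not> R \<subseteq> {0}"
  obtains \<theta> where "sl_automorphism \<theta>" "\<And>B. B \<in> Q \<Longrightarrow> \<theta> B *v axis 1 1 = 0"
proof -
  obtain W where W: "vec.subspace W" "W \<noteq> {0}" "W \<noteq> UNIV"
    and inv: "\<And>B w. B \<in> Q \<Longrightarrow> w \<in> W \<Longrightarrow> B *v w \<in> W"
    using invariant_subspace_of_abelian_normalized[OF comm norm tr ne] by metis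
  obtain w where w: "w \<in> W" "w \<noteq> 0" using W vec.subspace_0 by blast
  obtain x where x: "x \<notin> W" using W by blast
  have dim1: "vec.dim W \<noteq> 0" using w by auto
  have indep: "vec.dim W < 3"
    using vec.dim_psubset[of W UNIV] W by (simp add: vec.span_eq_iff[THEN iffD2] psubset_eq card_cart_basis)
  show ?thesis
  proof (cases "vec.dim W = 1")
    case True
    have "vec.span {w} = W"
      using vec.subspace_dim_equal[of "vec.span {w}" W] True w W(1)
      by (simp add: vec.span_minimal)
    have "\<exists>c. B *v w = c *s w" if "B \<in> Q" for B
      using inv[OF that w(1)] unfolding \<open>vec.span {w} = W\<close>[symmetric] by (auto simp: vec.span_singleton)
    then have kill: "B *v w = 0" if "B \<in> Q" for B
      using perfect_matrices_kill_eigenvector[OF perf] that by blast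
    obtain S T :: "complex^3^3" where ST: "S ** T = mat 1" "T ** S = mat 1" "S *v axis 1 1 = w"
      using invertible_matrix_with_first_column w(2) by metis
    show ?thesis
    proof (rule that)
      show "sl_automorphism (\<lambda>A. T ** A ** S)"
        by (rule sl_automorphism_conjugation) (use ST in auto)
      show "(T ** B ** S) *v axis 1 1 = 0" if "B \<in> Q" for B
        using kill[OF that] ST(3) by (simp add: matrix_vector_mul_assoc[symmetric])
    qed
  next
    case False
    with dim1 indep have dim2: "vec.dim W = 2" by linarith
    have full: "vec.span (insert x W) = UNIV"
      using dim2 x W(1) vec.dim_insert[of x W] vec.dim_eq_full[of "insert x W"]
      by (simp add: vec.span_eq_iff[THEN iffD2] card_cart_basis vec.dimension_def)
    obtain l where l: "Vector_Spaces.linear (*s) (*) l" "l x = 1" "\<And>s. s \<in> W \<Longrightarrow> l s = 0"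
      using linear_functional_vanishing_on_subspace[OF vec.vector_space_axioms W(1) x] by metis
    interpret l: Vector_Spaces.linear "(*s)" "(*)" l by (rule l)
    (* l is a covector with kernel W; invariance of W makes it an eigencovector of Q. *)
    have ker: "u - l u *s x \<in> W" for u
    proof -
      obtain k where k: "u - k *s x \<in> W"
        using full vec.span_breakdown_eq[of u x W] W(1) by (auto simp: vec.span_eq_iff[THEN iffD2])
      have "l (u - k *s x) = 0" by (rule l(3)) (rule k)
      then have "l u = k" using l(2) by (simp add: l.diff l.scale)
      with k show ?thesis by simp
    qed
    define k :: "complex^3" where "k = (\<chi> i. l (axis i 1))"
    have l_eq: "l u = (\<Sum>i\<in>UNIV. u $ i * k $ i)" for u
    proof -
      have "l u = l (\<Sum>i\<in>UNIV. u $ i *s axis i 1)" by (simp add: basis_expansion)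
      then show ?thesis by (simp add: l.sum l.scale k_def)
    qed
    have "k \<noteq> 0"
    proof
      assume "k = 0"
      then have "l x = 0" by (simp add: l_eq)
      with l(2) show False by simp
    qed
    have "\<exists>c. transpose B *v k = c *s k" if "B \<in> Q" for B
    proof -
      have lB: "l (B *v u) = l (B *v x) * l u" for u
      proof -
        have "l (B *v (u - l u *s x)) = 0"
          by (intro l(3) inv that ker)
        then show ?thesis
          by (simp add: matrix_vector_mult_diff_distrib vec.scale l.diff l.scale)
      qed
      have "(transpose B *v k) $ i = l (B *v x) * k $ i" for i
      proof -
        have "(transpose B *v k) $ i = l (B *v axis i 1)"
          by (simp add: l_eq matrix_vector_mult_def transpose_def axis_def if_distrib cong: if_cong)
        also have "\<dots> = l (B *v x) * k $ i"
          by (subst lB) (simp add: k_def)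
        finally show ?thesis .
      qed
      then show ?thesis by (auto simp: vec_eq_iff)
    qed
    then have kill: "transpose B *v k = 0" if "B \<in> Q" for B
      using perfect_matrices_kill_eigencovector[OF perf] that by blast
    obtain S T :: "complex^3^3" where ST: "S ** T = mat 1" "T ** S = mat 1" "S *v axis 1 1 = k"
      using invertible_matrix_with_first_column \<open>k \<noteq> 0\<close> by metis
    have neg: "(- A) *v v = - (A *v v)" for A :: "complex^3^3" and v
      by (simp add: matrix_vector_mult_def vec_eq_iff sum_negf)
    show ?thesis
    proof (rule that)
      show "sl_automorphism ((\<lambda>A. T ** A ** S) \<circ> (\<lambda>A. - transpose A))"
        by (intro sl_automorphism_compose sl_automorphism_conjugation sl_automorphism_negative_transpose)
          (use ST in auto)
      show "((\<lambda>A. T ** A ** S) \<circ> (\<lambda>A. - transpose A)) B *v axis 1 1 = 0" if "B \<in> Q" for B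
        using kill[OF that] ST(3) by (simp add: matrix_vector_mul_assoc[symmetric] neg)
    qed
  qed
qed

section \<open>Obstructions for perfect subalgebras\<close>

lemma commutator_in_perfect:
  assumes "Q = gl.bracket_span Q Q" "A \<in> Q" "B \<in> Q"
  shows "commutator A B \<in> Q"
  using gl.bracket_in_bracket_span[OF assms(2,3)] assms(1) by simp

lemma subspace_perfect: "Q = gl.bracket_span Q Q \<Longrightarrow> gl.subspace Q"
  using gl.subspace_bracket_span by metis

lemma perfect_subset_sl:
  assumes "Q = gl.bracket_span Q Q"
  shows "Q \<subseteq> sl"
proof -
  have "gl.bracket_span Q Q \<subseteq> sl"
    unfolding gl.bracket_span_def by (rule gl.span_minimal) (auto simp: commutator_in_sl subspace_sl)
  with assms show ?thesis by blast
qed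

text \<open>Suppose evaluation at \<open>v\<close> identifies \<open>Q\<close> with the whole space, and let \<open>E \<in> Q\<close> satisfy
  \<open>E v = v\<close>. Under this identification \<open>ad E\<close> becomes \<open>w \<mapsto> E w - w\<close>, whose trace is \<open>tr E - n = -n\<close>.
  But \<open>ad E\<close> is traceless, as \<open>E\<close> is a sum of commutators in \<open>Q\<close>. In the proof \<open>s\<close> is the inverse of
  the evaluation and \<open>T A\<close> is \<open>ad A\<close> transported along it.\<close>

lemma perfect_not_simply_transitive:
  fixes Q :: "('a::field_char_0^'n^'n) set"
  assumes perf: "Q = gl.bracket_span Q Q"
    and bij: "bij_betw (\<lambda>A. A *v v) Q UNIV"
  shows False
proof -
  note sub = subspace_perfect[OF perf]
  define s where "s = inv_into Q (\<lambda>A. A *v v)"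
  have sQ: "s w \<in> Q" for w
    using bij unfolding s_def bij_betw_def by (metis UNIV_I inv_into_into)
  have sv: "s w *v v = w" for w
    using bij unfolding s_def bij_betw_def by (metis (mono_tags, lifting) UNIV_I f_inv_into_f)
  have s_eq: "s w = A" if "A \<in> Q" "A *v v = w" for A w
    using bij sQ[of w] sv[of w] that unfolding bij_betw_def by (metis inj_onD)
  have s_add: "s (u + w) = s u + s w" for u w
    by (rule s_eq) (simp_all add: gl.subspace_add[OF sub] sQ matrix_vector_mult_add_rdistrib sv)
  have s_scale: "s (c *s w) = matrix_scale c (s w)" for c w
    by (rule s_eq) (simp_all add: gl.subspace_scale[OF sub] sQ matrix_vector_scale sv)
  define T where "T A = matrix (\<lambda>w. commutator A (s w) *v v)" for A
  have T: "T A *v w = commutator A (s w) *v v" for A w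
  proof -
    have "Vector_Spaces.linear (*s) (*s) (\<lambda>w. commutator A (s w) *v v)"
      by unfold_locales
        (simp_all add: s_add s_scale gl.bracket_simps matrix_vector_mult_add_rdistrib matrix_vector_scale)
    then show ?thesis unfolding T_def by (rule matrix_works)
  qed
  have T_add: "T (A + B) = T A + T B" for A B
    by (simp add: matrix_eq T matrix_vector_mult_add_rdistrib gl.bracket_simps)
  have T_scale: "T (matrix_scale c A) = matrix_scale c (T A)" for A c
    by (simp add: matrix_eq T matrix_vector_scale gl.bracket_simps)
  have T_comm: "T (commutator A B) = commutator (T A) (T B)" if "A \<in> Q" "B \<in> Q" for A B
  proof -
    have sT: "s (T C *v w) = commutator C (s w)" if "C \<in> Q" for C w
      by (rule s_eq) (simp_all add: T commutator_in_perfect[OF perf] that sQ)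
    have "T (commutator A B) *v w = commutator (T A) (T B) *v w" for w
    proof -
      have "commutator (T A) (T B) *v w = T A *v (T B *v w) - T B *v (T A *v w)"
        by (simp add: commutator_def matrix_vector_mult_diff_rdistrib matrix_vector_mul_assoc)
      also have "\<dots> = (commutator A (commutator B (s w)) - commutator B (commutator A (s w))) *v v"
        by (simp add: T[of A "T B *v w"] T[of B "T A *v w"] sT that matrix_vector_mult_diff_rdistrib)
      also have "\<dots> = T (commutator A B) *v w"
        by (simp add: gl.ad_derivation[of A B] T)
      finally show ?thesis by simp
    qed
    then show ?thesis by (simp add: matrix_eq)
  qed
  have "gl.bracket_span Q Q \<subseteq> {A. trace (T A) = 0}"
    unfolding gl.bracket_span_def
  proof (rule gl.span_minimal)
    show "gl.subspace {A. trace (T A) = 0}"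
      unfolding gl.subspace_def
    proof (intro conjI ballI allI)
      have "T 0 = 0" using T_add[of 0 0] by simp
      then show "0 \<in> {A. trace (T A) = 0}" by (simp add: trace_def)
    next
      show "A + B \<in> {A. trace (T A) = 0}" if "A \<in> {A. trace (T A) = 0}" "B \<in> {A. trace (T A) = 0}" for A B
        using that by (simp add: T_add trace_add)
    next
      show "matrix_scale c A \<in> {A. trace (T A) = 0}" if "A \<in> {A. trace (T A) = 0}" for c A
        using that by (simp add: T_scale trace_matrix_scale)
    qed
    show "{commutator A B |A B. A \<in> Q \<and> B \<in> Q} \<subseteq> {A. trace (T A) = 0}"
      using commutator_in_sl by (auto simp: T_comm sl_def)
  qed
  then have tr0: "trace (T (s v)) = 0" using perf sQ by blast
  have "T (s v) *v w = (s v - mat 1) *v w" for w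
    by (simp add: T commutator_def matrix_vector_mult_diff_rdistrib matrix_vector_mul_assoc[symmetric] sv)
  then have "T (s v) = s v - mat 1" by (simp add: matrix_eq)
  moreover have "trace (s v) = 0"
    using perfect_subset_sl[OF perf] sQ[of v] by (auto simp: sl_def)
  ultimately have "trace (T (s v)) = - of_nat CARD('n)"
    by (simp add: trace_sub trace_I)
  with tr0 show False by simp
qed

lemma sl_transitive:
  fixes w :: "'a::field^3"
  obtains A where "A \<in> sl" "A *v axis 1 1 = w"
proof
  let ?A = "vector [vector [w$1, 0, 0], vector [w$2, - w$1, 0], vector [w$3, 0, 0]] :: 'a^3^3"
  show "?A \<in> sl" by (simp add: sl_def trace_def sum_3)
  show "?A *v axis 1 1 = w"
    by (simp add: vec_eq_iff forall_3 matrix_vector_mult_def sum_3 axis_def)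
qed

text \<open>If \<open>R\<close> were nonzero, \<open>Q\<close> would, up to an automorphism, kill the first basis vector. Evaluating
  \<open>sl\<close> there would then give a space spanned by the images of \<open>Y1\<close> and \<open>Y2\<close>, whereas \<open>sl\<close> moves that vector everywhere.\<close>

lemma no_abelian_normalized_if_corank_le_2:
  fixes Q R :: "(complex^3^3) set"
  assumes perf: "Q = gl.bracket_span Q Q"
    and corank: "\<And>A. A \<in> sl \<Longrightarrow> \<exists>B\<in>Q. \<exists>a b. A = B + matrix_scale a Y1 + matrix_scale b Y2"
    and comm: "\<And>X Y. X \<in> R \<Longrightarrow> Y \<in> R \<Longrightarrow> commutator X Y = 0"
    and norm: "\<And>B X. B \<in> Q \<Longrightarrow> X \<in> R \<Longrightarrow> commutator B X \<in> R"
    and tr: "R \<subseteq> sl"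
  shows "R \<subseteq> {0}"
proof (rule ccontr)
  assume "\<not> R \<subseteq> {0}"
  then obtain \<theta> where \<theta>: "sl_automorphism \<theta>" and kill: "\<And>B. B \<in> Q \<Longrightarrow> \<theta> B *v axis 1 1 = 0"
    using perfect_with_abelian_normalized_kills_vector[of Q R] assms by (metis order_refl)
  interpret \<theta>: Vector_Spaces.linear matrix_scale matrix_scale \<theta>
    using \<theta> by (simp add: sl_automorphism_def)
  have "w \<in> vec.span {\<theta> Y1 *v axis 1 1, \<theta> Y2 *v axis 1 1}" for w
  proof -
    obtain A where A: "A \<in> sl" "A *v axis 1 1 = w" by (rule sl_transitive)
    then obtain A' where A': "A' \<in> sl" "\<theta> A' = A"
      using \<theta> unfolding sl_automorphism_def bij_betw_def by (metis imageE)
    then obtain B a b where B: "B \<in> Q" "A' = B + matrix_scale a Y1 + matrix_scale b Y2"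
      using corank by blast
    have w_eq: "w = a *s (\<theta> Y1 *v axis 1 1) + b *s (\<theta> Y2 *v axis 1 1)"
      using A(2) kill[OF B(1)] unfolding A'(2)[symmetric] B(2)
      by (simp add: \<theta>.add \<theta>.scale matrix_vector_mult_add_rdistrib matrix_vector_scale)
    show ?thesis
      unfolding w_eq by (intro vec.span_add vec.span_scale vec.span_base) simp_all
  qed
  then have "vec.dim (UNIV :: (complex^3) set) \<le> card {\<theta> Y1 *v axis 1 1, \<theta> Y2 *v axis 1 1}"
    by (intro vec.dim_le_card) auto
  also have "\<dots> \<le> 2" by (simp add: card_insert_le_m1)
  finally show False by (simp add: card_cart_basis)
qed

lemma trace_mult_sub_scalar:
  fixes A B :: "'a::field^'n^'n"
  shows "trace ((A - matrix_scale c (mat 1)) ** B) = trace (A ** B) - c * trace B"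
    "trace (A ** (B - matrix_scale c (mat 1))) = trace (A ** B) - c * trace A"
  by (simp_all add: matrix_diff_distrib trace_sub matrix_mult_scale trace_matrix_scale)

lemma traceless_part_in_sl:
  fixes A :: "'a::field_char_0^'n^'n"
  shows "A - matrix_scale (trace A / of_nat CARD('n)) (mat 1) \<in> sl"
  by (simp add: sl_def trace_sub trace_scalar_matrix)

lemma trace_form_nondegenerate_on_sl:
  fixes X :: "'a::field_char_0^'n^'n"
  assumes X: "X \<in> sl" and orth: "\<And>A. A \<in> sl \<Longrightarrow> trace (X ** A) = 0"
  shows "X = 0"
proof -
  have "X $ i $ j = 0" for i j
  proof -
    let ?E = "matrix_unit j i :: 'a^'n^'n"
    have "trace (X ** ?E) = trace (X ** (?E - matrix_scale (trace ?E / of_nat CARD('n)) (mat 1)))"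
      using X by (simp add: trace_mult_sub_scalar sl_def)
    also have "\<dots> = 0" by (rule orth[OF traceless_part_in_sl])
    finally show ?thesis
      by (simp add: trace_def matrix_unit_mult)
  qed
  then show ?thesis by (simp add: vec_eq_iff)
qed

lemma functional_as_trace_on_sl:
  fixes l :: "'a::field_char_0^'n^'n \<Rightarrow> 'a"
  assumes "Vector_Spaces.linear matrix_scale (*) l"
  obtains X where "X \<in> sl" "\<And>A. A \<in> sl \<Longrightarrow> trace (X ** A) = l A"
proof -
  interpret l: Vector_Spaces.linear matrix_scale "(*)" l by fact
  define X0 :: "'a^'n^'n" where "X0 = (\<chi> i j. l (matrix_unit j i))"
  have l_eq: "l A = trace (X0 ** A)" for A
  proof -
    have A: "A = (\<Sum>j\<in>UNIV. \<Sum>i\<in>UNIV. matrix_scale (A $ j $ i) (matrix_unit j i))"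
    proof -
      have "(\<Sum>j\<in>UNIV. \<Sum>i\<in>UNIV. A $ j $ i * matrix_unit j i $ a $ b) = A $ a $ b" for a b
      proof -
        have "(\<Sum>i\<in>UNIV. A $ j $ i * matrix_unit j i $ a $ b) = (if a = j then A $ j $ b else 0)" for j
          by (cases "a = j") (simp_all add: matrix_unit_def if_distrib[of "(*) _"] cong: if_cong)
        then show ?thesis by simp
      qed
      then show ?thesis by (simp add: vec_eq_iff matrix_scale_def)
    qed
    have "l A = (\<Sum>j\<in>UNIV. \<Sum>i\<in>UNIV. A $ j $ i * l (matrix_unit j i))"
      by (subst A) (simp add: l.sum l.scale)
    also have "\<dots> = (\<Sum>i\<in>UNIV. \<Sum>j\<in>UNIV. X0 $ i $ j * A $ j $ i)"
      by (subst sum.swap) (simp add: X0_def mult.commute)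
    finally show ?thesis by (simp add: trace_def matrix_matrix_mult_def)
  qed
  show ?thesis
  proof (rule that)
    show "X0 - matrix_scale (trace X0 / of_nat CARD('n)) (mat 1) \<in> sl"
      by (rule traceless_part_in_sl)
    show "trace ((X0 - matrix_scale (trace X0 / of_nat CARD('n)) (mat 1)) ** A) = l A" if "A \<in> sl" for A
      using that by (simp add: trace_mult_sub_scalar l_eq sl_def)
  qed
qed

lemma trace_commutator_swap:
  fixes A B X :: "'a::field^'n^'n"
  shows "trace (commutator B X ** A) = - trace (X ** commutator B A)"
proof -
  have "trace (B ** X ** A) = trace (X ** (A ** B))"
    using trace_mul_sym[of B "X ** A"] by (simp add: matrix_mul_assoc)
  then show ?thesis
    by (simp add: commutator_def matrix_diff_distrib trace_sub matrix_mul_assoc)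
qed

text \<open>Let \<open>N\<close> be the orthogonal complement of \<open>Q\<close> in \<open>sl\<close> for the trace form: it is nonzero, at
  most two-dimensional and normalized by \<open>Q\<close>. Either \<open>N\<close> is commutative, or its commutators form a
  line, again normalized by \<open>Q\<close> because \<open>ad B\<close> is a derivation. In both cases there is a nonzero
  commuting set normalized by \<open>Q\<close>, which the preceding lemma forbids. Pairing with \<open>Y1\<close> and \<open>Y2\<close>
  gives injective coordinates \<open>(\<alpha>, \<beta>)\<close> on \<open>N\<close>.\<close>

theorem no_perfect_subalgebra_of_corank_le_2:
  fixes Q :: "(complex^3^3) set"
  assumes perf: "Q = gl.bracket_span Q Q" and proper: "Q \<noteq> sl"
    and corank: "\<And>A. A \<in> sl \<Longrightarrow> \<exists>B\<in>Q. \<exists>a b. A = B + matrix_scale a Y1 + matrix_scale b Y2"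
  shows False
proof -
  define N where "N = {X \<in> sl. \<forall>A\<in>Q. trace (X ** A) = 0}"
  have sub_sl: "gl.subspace (sl :: (complex^3^3) set)" by (rule subspace_sl)
  have N_diff: "X - Y \<in> N" if "X \<in> N" "Y \<in> N" for X Y
    using that by (auto simp: N_def matrix_diff_distrib trace_sub gl.subspace_diff[OF sub_sl])
  have N_scale: "matrix_scale c X \<in> N" if "X \<in> N" for c X
    using that by (auto simp: N_def matrix_mult_scale trace_matrix_scale gl.subspace_scale[OF sub_sl])
  have N_norm: "commutator B X \<in> N" if "B \<in> Q" "X \<in> N" for B X
    using that by (auto simp: N_def commutator_in_sl trace_commutator_swap commutator_in_perfect[OF perf])
  have N_ne: "\<not> N \<subseteq> {0}"
  proof -
    obtain A where A: "A \<in> sl" "A \<notin> Q" using perfect_subset_sl[OF perf] proper by blast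
    obtain l where l: "Vector_Spaces.linear matrix_scale (*) l" "l A = 1" "\<And>B. B \<in> Q \<Longrightarrow> l B = 0"
      using linear_functional_vanishing_on_subspace[OF gl.vector_space_axioms subspace_perfect[OF perf] A(2)]
      by metis
    obtain X where X: "X \<in> sl" "\<And>A. A \<in> sl \<Longrightarrow> trace (X ** A) = l A"
      using functional_as_trace_on_sl[OF l(1)] by metis
    have "X \<in> N" using X l(3) perfect_subset_sl[OF perf] by (auto simp: N_def)
    moreover have "X \<noteq> 0" using X(2)[OF A(1)] l(2) by (auto simp: trace_def)
    ultimately show ?thesis by blast
  qed
  define \<alpha> \<beta> where "\<alpha> X = trace (X ** Y1)" and "\<beta> X = trace (X ** Y2)" for X
  have coords: "X = 0" if X: "X \<in> N" and "\<alpha> X = 0" "\<beta> X = 0" for X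
  proof (rule trace_form_nondegenerate_on_sl)
    show "X \<in> sl" using X by (simp add: N_def)
    fix A :: "complex^3^3" assume "A \<in> sl"
    then obtain B a b where "B \<in> Q" "A = B + matrix_scale a Y1 + matrix_scale b Y2"
      using corank by blast
    then show "trace (X ** A) = 0"
      using that by (simp add: N_def \<alpha>_def \<beta>_def matrix_add_ldistrib trace_add matrix_mult_scale trace_matrix_scale)
  qed
  have lin: "\<alpha> (X - Y) = \<alpha> X - \<alpha> Y" "\<beta> (X - Y) = \<beta> X - \<beta> Y"
    "\<alpha> (matrix_scale c X) = c * \<alpha> X" "\<beta> (matrix_scale c X) = c * \<beta> X" for X Y c
    by (simp_all add: \<alpha>_def \<beta>_def matrix_diff_distrib trace_sub matrix_mult_scale trace_matrix_scale)
  have no_R: "R \<subseteq> {0}" if "\<And>X Y. X \<in> R \<Longrightarrow> Y \<in> R \<Longrightarrow> commutator X Y = 0"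
    "\<And>B X. B \<in> Q \<Longrightarrow> X \<in> R \<Longrightarrow> commutator B X \<in> R" "R \<subseteq> sl" for R
    using no_abelian_normalized_if_corank_le_2[OF perf corank that] by blast
  obtain X Y where X: "X \<in> N" and Y: "Y \<in> N" and XY: "commutator X Y \<noteq> 0"
    using no_R[of N] N_norm N_ne by (auto simp: N_def)
  define Z where "Z = commutator X Y"
  define \<Delta> where "\<Delta> = \<alpha> X * \<beta> Y - \<beta> X * \<alpha> Y"
  have "\<Delta> \<noteq> 0"
  proof
    assume \<Delta>: "\<Delta> = 0"
    have 1: "matrix_scale (\<beta> Y) X - matrix_scale (\<beta> X) Y = 0"
      by (rule coords) (use \<Delta> in \<open>simp_all add: N_diff N_scale X Y lin \<Delta>_def algebra_simps\<close>)
    have 2: "matrix_scale (\<alpha> Y) X - matrix_scale (\<alpha> X) Y = 0"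
      by (rule coords) (use \<Delta> in \<open>simp_all add: N_diff N_scale X Y lin \<Delta>_def algebra_simps\<close>)
    have "matrix_scale (\<beta> X) Z = 0" "matrix_scale (\<alpha> X) Z = 0"
      using arg_cong[OF 1, of "commutator X"] arg_cong[OF 2, of "commutator X"]
      by (simp_all add: gl.bracket_simps gl.alternating Z_def)
    then have "\<alpha> X = 0" "\<beta> X = 0" using XY by (auto simp: Z_def)
    then have "X = 0" using coords X by blast
    with XY show False by (simp add: gl.bracket_simps)
  qed
  have span: "\<exists>p q. V = matrix_scale p X - matrix_scale q Y" if V: "V \<in> N" for V
  proof -
    (* Cramer's rule for the coordinates of V. *)
    let ?p = "(\<alpha> V * \<beta> Y - \<beta> V * \<alpha> Y) / \<Delta>" and ?q = "(\<beta> X * \<alpha> V - \<alpha> X * \<beta> V) / \<Delta>"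
    have "V - (matrix_scale ?p X - matrix_scale ?q Y) = 0"
    proof (rule coords)
      show "V - (matrix_scale ?p X - matrix_scale ?q Y) \<in> N"
        by (intro N_diff N_scale V X Y)
      have "?p * \<alpha> X - ?q * \<alpha> Y = \<alpha> V * \<Delta> / \<Delta>"
        unfolding times_divide_eq_left diff_divide_distrib[symmetric]
        by (simp add: \<Delta>_def algebra_simps)
      then show "\<alpha> (V - (matrix_scale ?p X - matrix_scale ?q Y)) = 0"
        using \<open>\<Delta> \<noteq> 0\<close> by (simp only: lin) simp
      have "?p * \<beta> X - ?q * \<beta> Y = \<beta> V * \<Delta> / \<Delta>"
        unfolding times_divide_eq_left diff_divide_distrib[symmetric]
        by (simp add: \<Delta>_def algebra_simps)
      then show "\<beta> (V - (matrix_scale ?p X - matrix_scale ?q Y)) = 0"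
        using \<open>\<Delta> \<noteq> 0\<close> by (simp only: lin) simp
    qed
    then show ?thesis by (metis eq_iff_diff_eq_0)
  qed
  have N_comm: "\<exists>c. commutator V W = matrix_scale c Z" if VW: "V \<in> N" "W \<in> N" for V W
  proof -
    obtain p q p' q' where "V = matrix_scale p X - matrix_scale q Y" "W = matrix_scale p' X - matrix_scale q' Y"
      using span VW by metis
    then have "commutator V W = matrix_scale (q * p' - p * q') Z"
      using gl.bracket_antisym[of Y X]
      by (simp add: gl.bracket_simps gl.alternating Z_def gl.scale_left_diff_distrib mult.commute)
    then show ?thesis by blast
  qed
  have "range (\<lambda>c. matrix_scale c Z) \<subseteq> {0}"
  proof (rule no_R)
    show "commutator U V = 0" if "U \<in> range (\<lambda>c. matrix_scale c Z)" "V \<in> range (\<lambda>c. matrix_scale c Z)" for U V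
      using that by (auto simp: gl.bracket_simps gl.alternating)
    show "range (\<lambda>c. matrix_scale c Z) \<subseteq> sl"
      by (auto simp: Z_def intro!: gl.subspace_scale[OF sub_sl] commutator_in_sl)
    fix B U assume B: "B \<in> Q" and "U \<in> range (\<lambda>c. matrix_scale c Z)"
    then obtain c where U: "U = matrix_scale c Z" by blast
    obtain d e where "commutator (commutator B X) Y = matrix_scale d Z" "commutator X (commutator B Y) = matrix_scale e Z"
      using N_comm N_norm B X Y by metis
    then have "commutator B U = matrix_scale (c * (d + e)) Z"
      unfolding U gl.bracket_simps unfolding Z_def gl.ad_derivation[of B X Y]
      by (simp add: gl.scale_left_distrib distrib_left gl.scale_right_distrib)
    then show "commutator B U \<in> range (\<lambda>c. matrix_scale c Z)" by blast
  qed
  then have "matrix_scale 1 Z = 0" by blast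
  with XY show False by (simp add: Z_def)
qed

section \<open>The stabilizer of a vector\<close>

text \<open>As a Lie algebra this is \<open>sl\<^sub>2 \<ltimes> k\<^sup>2\<close>: the lower right block is the \<open>sl\<^sub>2\<close> part, the rest of the
  first row the translation part.\<close>

definition e1_stabilizer :: "('a::field^3^3) set"
  where "e1_stabilizer = {A \<in> sl. A *v axis 1 1 = 0}"

text \<open>Coordinates on the stabilizer: \<open>(u, w)\<close> is the translation part and \<open>(a, b, c)\<close> are the
  coefficients of the \<open>sl\<^sub>2\<close> part with respect to the basis \<open>h\<close>, \<open>e\<close>, \<open>f\<close>.\<close>

definition stab_mat :: "'a::field \<Rightarrow> 'a \<Rightarrow> 'a \<Rightarrow> 'a \<Rightarrow> 'a \<Rightarrow> 'a^3^3"
  where "stab_mat u w a b c = vector [vector [0, u, w], vector [0, a, b], vector [0, c, - a]]"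

lemma stab_mat_nth [simp]:
  "stab_mat u w a b c $ i $ 1 = 0"
  "stab_mat u w a b c $ 1 $ 2 = u" "stab_mat u w a b c $ 1 $ 3 = w"
  "stab_mat u w a b c $ 2 $ 2 = a" "stab_mat u w a b c $ 2 $ 3 = b"
  "stab_mat u w a b c $ 3 $ 2 = c" "stab_mat u w a b c $ 3 $ 3 = - a"
  using exhaust_3[of i] by (auto simp: stab_mat_def)

lemma mem_e1_stabilizer_iff:
  "A \<in> e1_stabilizer \<longleftrightarrow> A = stab_mat (A$1$2) (A$1$3) (A$2$2) (A$2$3) (A$3$2)"
  by (auto simp: e1_stabilizer_def sl_def trace_def sum_3 vec_eq_iff[where 'a = "'a^3"] vec_eq_iff[where 'a = 'a]
      forall_3 matrix_vector_mult_def axis_def eq_neg_iff_add_eq_0 add.commute)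

lemma e1_stabilizerE:
  assumes "A \<in> e1_stabilizer"
  obtains u w a b c where "A = stab_mat u w a b c"
  using assms mem_e1_stabilizer_iff by blast

lemma stab_mat_simps:
  "stab_mat u w a b c + stab_mat u' w' a' b' c' = stab_mat (u + u') (w + w') (a + a') (b + b') (c + c')"
  "stab_mat u w a b c - stab_mat u' w' a' b' c' = stab_mat (u - u') (w - w') (a - a') (b - b') (c - c')"
  "matrix_scale k (stab_mat u w a b c) = stab_mat (k * u) (k * w) (k * a) (k * b) (k * c)"
  "commutator (stab_mat u w a b c) (stab_mat u' w' a' b' c') =
    stab_mat (u * a' + w * c' - u' * a - w' * c) (u * b' - w * a' - u' * b + w' * a)
      (b * c' - b' * c) (2 * (a * b' - b * a')) (2 * (c * a' - a * c'))"
  by (simp_all add: vec_eq_iff forall_3 matrix_scale_def commutator_def matrix_matrix_mult_def sum_3 algebra_simps)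

lemma stab_mat_eq_iff [simp]:
  "stab_mat u w a b c = stab_mat u' w' a' b' c' \<longleftrightarrow> u = u' \<and> w = w' \<and> a = a' \<and> b = b' \<and> c = c'"
  by (metis stab_mat_nth)

lemma stab_mat_eq_0_iff [simp]:
  "stab_mat u w a b c = 0 \<longleftrightarrow> u = 0 \<and> w = 0 \<and> a = 0 \<and> b = 0 \<and> c = 0"
proof -
  have "0 = stab_mat 0 0 0 0 (0 :: 'a)"
    by (simp add: vec_eq_iff forall_3)
  then show ?thesis using stab_mat_eq_iff by metis
qed

lemma stab_mat_in_e1_stabilizer [simp]: "stab_mat u w a b c \<in> e1_stabilizer"
  by (simp add: mem_e1_stabilizer_iff)

text \<open>The translations form an irreducible \<open>sl\<^sub>2\<close>-module.\<close>

lemma translations_in_submodule: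
  fixes J P :: "('a::field^3^3) set"
  assumes J: "gl.subspace J"
    and P: "\<And>a b c. \<exists>u w. stab_mat u w a b c \<in> P"
    and PJ: "\<And>p r. p \<in> P \<Longrightarrow> r \<in> J \<Longrightarrow> commutator p r \<in> J"
    and r: "stab_mat u w 0 0 0 \<in> J" "u \<noteq> 0 \<or> w \<noteq> 0"
  shows "stab_mat x y 0 0 0 \<in> J"
proof -
  have act: "stab_mat (- (u * a + w * c)) (w * a - u * b) 0 0 0 \<in> J" if "stab_mat u w 0 0 0 \<in> J" for u w a b c
  proof -
    obtain p q where "stab_mat p q a b c \<in> P" using P by blast
    from PJ[OF this that] show ?thesis by (simp add: stab_mat_simps algebra_simps)
  qed
  have *: "stab_mat x y 0 0 0 \<in> J" if r: "stab_mat u w 0 0 0 \<in> J" and "u \<noteq> 0" for u w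
  proof -
    have y: "stab_mat 0 z 0 0 0 \<in> J" for z
      using gl.subspace_scale[OF J act[OF r, of 0 0 1], of "- (z / u)"] \<open>u \<noteq> 0\<close>
      by (simp add: stab_mat_simps)
    have "stab_mat u 0 0 0 0 \<in> J"
      using gl.subspace_diff[OF J r y[of w]] by (simp add: stab_mat_simps)
    from gl.subspace_add[OF J gl.subspace_scale[OF J this, of "x / u"] y[of y]]
    show ?thesis using \<open>u \<noteq> 0\<close> by (simp add: stab_mat_simps)
  qed
  show ?thesis
  proof (cases "u = 0")
    case True
    then show ?thesis using r *[OF act[OF r(1), of 0 1 0]] by simp
  next
    case False
    then show ?thesis using *[OF r(1)] by simp
  qed
qed

text \<open>In the coordinates \<open>(a, b, c)\<close> the bracket of \<open>sl\<^sub>2\<close> is a linear image of the cross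
  product. If the blocks of \<open>P\<close> lie in the plane orthogonal to a covector \<open>k\<close>, their cross products
  are multiples of \<open>k\<close>; so by perfectness all blocks lie on one line, then all blocks vanish, and then
  \<open>P\<close> is abelian and hence zero.\<close>

lemma perfect_blocks_exhaust_sl2:
  fixes P :: "('a::field^3^3) set"
  assumes sub: "gl.subspace P" and stab: "P \<subseteq> e1_stabilizer"
    and perf: "P \<subseteq> gl.bracket_span P P"
    and ne: "\<not> P \<subseteq> {0}"
  shows "\<exists>u w. stab_mat u w a b c \<in> P"
proof -
  have kernel: "P \<subseteq> K" if "gl.subspace K" "\<And>p q. p \<in> P \<Longrightarrow> q \<in> P \<Longrightarrow> commutator p q \<in> K" for K
  proof -
    have "gl.bracket_span P P \<subseteq> K"
      unfolding gl.bracket_span_def by (rule gl.span_minimal) (use that in auto)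
    with perf show ?thesis by blast
  qed
  have abelian: False if "\<And>p q. p \<in> P \<Longrightarrow> q \<in> P \<Longrightarrow> commutator p q = 0"
    using kernel[of "{0}"] that ne by (simp add: gl.subspace_single_0)
  have radical: False if rad: "\<And>p. p \<in> P \<Longrightarrow> \<exists>u w. p = stab_mat u w 0 0 0"
  proof (rule abelian)
    fix p q assume "p \<in> P" "q \<in> P"
    then obtain u w u' w' where "p = stab_mat u w 0 0 0" "q = stab_mat u' w' 0 0 0"
      using rad by metis
    then show "commutator p q = 0" by (simp add: stab_mat_simps)
  qed
  define \<pi> where "\<pi> A = (vector [A$2$2, A$2$3, A$3$2] :: 'a^3)" for A :: "'a^3^3"
  interpret \<pi>: Vector_Spaces.linear matrix_scale "(*s)" \<pi>
    by unfold_locales (simp_all add: \<pi>_def vec_eq_iff forall_3 matrix_scale_def)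
  have sub\<pi>: "vec.subspace (\<pi> ` P)"
    using sub by (rule \<pi>.subspace_image)
  have "\<pi> ` P = UNIV"
  proof (rule ccontr)
    assume "\<pi> ` P \<noteq> UNIV"
    then obtain x where "x \<notin> \<pi> ` P" by blast
    then obtain l where l: "Vector_Spaces.linear (*s) (*) l" "l x = 1" "\<And>s. s \<in> \<pi> ` P \<Longrightarrow> l s = 0"
      using linear_functional_vanishing_on_subspace[OF vec.vector_space_axioms sub\<pi>] by metis
    interpret l: Vector_Spaces.linear "(*s)" "(*)" l by (rule l)
    define k where "k i = l (axis i 1)" for i
    have l_eq: "l v = v$1 * k 1 + v$2 * k 2 + v$3 * k 3" for v
    proof -
      have "l v = l (\<Sum>i\<in>UNIV. v $ i *s axis i 1)" by (simp add: basis_expansion)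
      then show ?thesis by (simp add: l.sum l.scale l.add k_def sum_3)
    qed
    have k: "k 1 \<noteq> 0 \<or> k 2 \<noteq> 0 \<or> k 3 \<noteq> 0"
      using l(2) by (auto simp: l_eq)
    have plane: "a * k 1 + b * k 2 + c * k 3 = 0" if "stab_mat u w a b c \<in> P" for u w a b c
      using l(3)[OF imageI[OF that]] by (simp add: \<pi>_def l_eq)
    let ?K = "{A :: 'a^3^3. \<exists>t. A$2$2 = t * k 1 \<and> A$2$3 = 2 * (t * k 3) \<and> A$3$2 = 2 * (t * k 2)}"
    have "P \<subseteq> ?K"
    proof (rule kernel)
      show "gl.subspace ?K"
        unfolding gl.subspace_def
      proof (intro conjI ballI allI)
        show "0 \<in> ?K" by (auto intro!: exI[of _ 0])
        show "A + B \<in> ?K" if "A \<in> ?K" "B \<in> ?K" for A B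
        proof -
          from that obtain s t where "A$2$2 = s * k 1 \<and> A$2$3 = 2 * (s * k 3) \<and> A$3$2 = 2 * (s * k 2)"
            "B$2$2 = t * k 1 \<and> B$2$3 = 2 * (t * k 3) \<and> B$3$2 = 2 * (t * k 2)" by blast
          then show ?thesis by (auto intro!: exI[of _ "s + t"] simp: algebra_simps)
        qed
        show "matrix_scale d A \<in> ?K" if "A \<in> ?K" for A d
        proof -
          from that obtain s where "A$2$2 = s * k 1 \<and> A$2$3 = 2 * (s * k 3) \<and> A$3$2 = 2 * (s * k 2)"
            by blast
          then show ?thesis by (auto intro!: exI[of _ "d * s"] simp: matrix_scale_def algebra_simps)
        qed
      qed
      fix p q assume pq: "p \<in> P" "q \<in> P"
      then obtain u w a b c u' w' a' b' c' where p: "p = stab_mat u w a b c" and q: "q = stab_mat u' w' a' b' c'"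
        using stab e1_stabilizerE by (metis subsetD)
      have 1: "a * k 1 + b * k 2 + c * k 3 = 0" and 2: "a' * k 1 + b' * k 2 + c' * k 3 = 0"
        using plane pq p q by blast+
      let ?x = "b * c' - b' * c" and ?y = "c * a' - a * c'" and ?z = "a * b' - b * a'"
      have xy: "?x * k 2 = ?y * k 1" and yz: "?y * k 3 = ?z * k 2" and zx: "?z * k 1 = ?x * k 3"
        using 1 2 by algebra+
      have "\<exists>t. ?x = t * k 1 \<and> ?y = t * k 2 \<and> ?z = t * k 3"
        using k
      proof (elim disjE)
        assume "k 1 \<noteq> 0"
        then show ?thesis using xy zx by (intro exI[of _ "?x / k 1"]) (simp add: field_simps)
      next
        assume "k 2 \<noteq> 0"
        then show ?thesis using xy yz by (intro exI[of _ "?y / k 2"]) (simp add: field_simps)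
      next
        assume "k 3 \<noteq> 0"
        then show ?thesis using zx yz by (intro exI[of _ "?z / k 3"]) (simp add: field_simps)
      qed
      then obtain t where t: "?x = t * k 1 \<and> ?y = t * k 2 \<and> ?z = t * k 3" ..
      have entries: "commutator p q $ 2 $ 2 = ?x" "commutator p q $ 2 $ 3 = 2 * ?z"
        "commutator p q $ 3 $ 2 = 2 * ?y"
        unfolding p q stab_mat_simps(4) stab_mat_nth by (rule refl)+
      have "commutator p q $ 2 $ 2 = t * k 1 \<and> commutator p q $ 2 $ 3 = 2 * (t * k 3)
          \<and> commutator p q $ 3 $ 2 = 2 * (t * k 2)"
        unfolding entries t[THEN conjunct1] t[THEN conjunct2, THEN conjunct1] t[THEN conjunct2, THEN conjunct2]
        by (intro conjI refl)
      then have "\<exists>t. commutator p q $ 2 $ 2 = t * k 1 \<and> commutator p q $ 2 $ 3 = 2 * (t * k 3)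
          \<and> commutator p q $ 3 $ 2 = 2 * (t * k 2)" ..
      then show "commutator p q \<in> ?K"
        by (simp only: mem_Collect_eq)
    qed
    have "P \<subseteq> {A. A$2$2 = 0 \<and> A$2$3 = 0 \<and> A$3$2 = 0}" (is "_ \<subseteq> ?Z")
    proof (rule kernel)
      show "gl.subspace ?Z"
        by (auto simp: gl.subspace_def matrix_scale_def)
      fix p q assume pq: "p \<in> P" "q \<in> P"
      obtain u w a b c u' w' a' b' c' where p: "p = stab_mat u w a b c" and q: "q = stab_mat u' w' a' b' c'"
        using stab e1_stabilizerE pq by (metis subsetD)
      obtain s where "a = s * k 1 \<and> b = 2 * (s * k 3) \<and> c = 2 * (s * k 2)"
        using subsetD[OF \<open>P \<subseteq> ?K\<close> pq(1)] by (auto simp: p)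
      moreover obtain t where "a' = t * k 1 \<and> b' = 2 * (t * k 3) \<and> c' = 2 * (t * k 2)"
        using subsetD[OF \<open>P \<subseteq> ?K\<close> pq(2)] by (auto simp: q)
      ultimately show "commutator p q \<in> ?Z"
        by (simp add: p q stab_mat_simps)
    qed
    then have Z: "p$2$2 = 0 \<and> p$2$3 = 0 \<and> p$3$2 = 0" if "p \<in> P" for p
      using that by blast
    have "\<exists>u w. p = stab_mat u w 0 0 0" if "p \<in> P" for p
    proof -
      have "p \<in> e1_stabilizer" using that stab by blast
      with Z[OF that] show ?thesis
        using mem_e1_stabilizer_iff[of p] by auto
    qed
    then show False by (rule radical)
  qed
  then obtain p where p: "p \<in> P" "\<pi> p = vector [a, b, c]" by (metis UNIV_I imageE)
  then have "p$2$2 = a" "p$2$3 = b" "p$3$2 = c"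
    by (simp_all add: \<pi>_def vec_eq_iff forall_3)
  moreover have "p = stab_mat (p$1$2) (p$1$3) (p$2$2) (p$2$3) (p$3$2)"
    using p(1) stab mem_e1_stabilizer_iff[of p] by blast
  ultimately have "p = stab_mat (p$1$2) (p$1$3) a b c" by simp
  with p(1) have "stab_mat (p$1$2) (p$1$3) a b c \<in> P" by simp
  then show ?thesis by blast
qed

text \<open>The blocks of \<open>P\<close> exhaust \<open>sl\<^sub>2\<close>, and an abelian ideal of \<open>sl\<^sub>2\<close> is zero. Therefore \<open>R\<close> consists
  of translations, and by irreducibility contains all of them.\<close>

theorem perfect_in_e1_stabilizer_full:
  fixes P R :: "('a::field_char_0^3^3) set"
  assumes sub: "gl.subspace P" and stab: "P \<subseteq> e1_stabilizer"
    and perf: "P \<subseteq> gl.bracket_span P P"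
    and R: "gl.subspace R" "R \<subseteq> P" "\<not> R \<subseteq> {0}"
    and comm: "\<And>X Y. X \<in> R \<Longrightarrow> Y \<in> R \<Longrightarrow> commutator X Y = 0"
    and norm: "\<And>B X. B \<in> P \<Longrightarrow> X \<in> R \<Longrightarrow> commutator B X \<in> R"
  shows "P = e1_stabilizer"
proof -
  have surj: "\<exists>u w. stab_mat u w a b c \<in> P" for a b c
    using perfect_blocks_exhaust_sl2[OF sub stab perf] R by blast
  have zero: "a = 0 \<and> b = 0 \<and> c = 0" if r: "stab_mat u w a b c \<in> R" for u w a b c
  proof -
    (* An element r of an abelian ideal satisfies (ad r)^2 = 0; test this on e and on f. *)
    have cc: "commutator (commutator p (stab_mat u w a b c)) (stab_mat u w a b c) = 0" if "p \<in> P" for p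
      using comm[OF norm[OF that r] r] .
    obtain x y where e: "stab_mat x y 0 1 0 \<in> P" using surj by blast
    obtain x' y' where f: "stab_mat x' y' 0 0 1 \<in> P" using surj by blast
    have "c = 0" using cc[OF e] by (simp add: stab_mat_simps)
    moreover have "b = 0" using cc[OF f] by (simp add: stab_mat_simps)
    moreover have "a = 0" using cc[OF f] calculation by (simp add: stab_mat_simps)
    ultimately show ?thesis by simp
  qed
  obtain r where r: "r \<in> R" "r \<noteq> 0" using R by blast
  then obtain u w a b c where "r = stab_mat u w a b c"
    using e1_stabilizerE stab R(2) by blast
  with r zero[of u w a b c] have uw: "r = stab_mat u w 0 0 0" "u \<noteq> 0 \<or> w \<noteq> 0"
    by auto
  have trans: "stab_mat x y 0 0 0 \<in> P" for x y
    using translations_in_submodule[OF R(1) surj norm, of u w x y] r uw R(2) by blast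
  have "stab_mat u w a b c \<in> P" for u w a b c
  proof -
    obtain x y where "stab_mat x y a b c \<in> P" using surj by blast
    from gl.subspace_add[OF sub this trans[of "u - x" "w - y"]]
    show ?thesis by (simp add: stab_mat_simps)
  qed
  then show ?thesis using stab by (blast elim: e1_stabilizerE)
qed

text \<open>Bracketing a nonzero element of \<open>J\<close> with translations yields a nonzero translation in \<open>J\<close>, hence
  all of them. If \<open>J\<close> has a further element, the usual \<open>ad e\<close>, \<open>ad f\<close> argument for the simplicity of
  \<open>sl\<^sub>2\<close> produces \<open>e\<close>, \<open>f\<close> and \<open>h\<close>.\<close>

theorem e1_stabilizer_ideals:
  fixes J :: "('a::field_char_0^3^3) set"
  assumes J: "gl.subspace J" "J \<subseteq> e1_stabilizer" "\<not> J \<subseteq> {0}"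
    and ideal: "\<And>B X. B \<in> e1_stabilizer \<Longrightarrow> X \<in> J \<Longrightarrow> commutator B X \<in> J"
  shows "J = e1_stabilizer \<or> J = {stab_mat u w 0 0 0 | u w. True}"
proof -
  have surj: "\<exists>u w. stab_mat u w a b c \<in> (e1_stabilizer :: ('a^3^3) set)" for a b c by simp
  note ideal' = ideal[OF stab_mat_in_e1_stabilizer]
  obtain x where x: "x \<in> J" "x \<noteq> 0" using J(3) by blast
  obtain u w a b c where x_eq: "x = stab_mat u w a b c"
    using e1_stabilizerE x J(2) by blast
  have r: "stab_mat u w a b c \<in> J" and nz: "\<not> (u = 0 \<and> w = 0 \<and> a = 0 \<and> b = 0 \<and> c = 0)"
    using x x_eq by simp_all
  have "\<exists>u w. stab_mat u w 0 0 0 \<in> J \<and> (u \<noteq> 0 \<or> w \<noteq> 0)"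
  proof (cases "a = 0 \<and> b = 0 \<and> c = 0")
    case True
    then show ?thesis using r nz by auto
  next
    case False
    have 1: "stab_mat a b 0 0 0 \<in> J"
      using ideal'[OF r, of 1 0 0 0 0] by (simp add: stab_mat_simps)
    have 2: "stab_mat c (- a) 0 0 0 \<in> J"
      using ideal'[OF r, of 0 1 0 0 0] by (simp add: stab_mat_simps)
    from 1 2 False show ?thesis by auto
  qed
  then obtain u' w' where u'w': "stab_mat u' w' 0 0 0 \<in> J" "u' \<noteq> 0 \<or> w' \<noteq> 0" by blast
  have trans: "stab_mat x y 0 0 0 \<in> J" for x y
    by (rule translations_in_submodule[where P = e1_stabilizer, OF J(1) _ _ u'w']) (simp_all add: ideal)
  show ?thesis
  proof (cases "\<exists>u w a b c. stab_mat u w a b c \<in> J \<and> \<not> (a = 0 \<and> b = 0 \<and> c = 0)")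
    case False
    have "J \<subseteq> {stab_mat u w 0 0 0 | u w. True}"
    proof
      fix x assume x: "x \<in> J"
      then have "x \<in> e1_stabilizer" using J(2) by blast
      then obtain u w a b c where "x = stab_mat u w a b c" by (rule e1_stabilizerE)
      with x False show "x \<in> {stab_mat u w 0 0 0 | u w. True}" by auto
    qed
    with trans show ?thesis by auto
  next
    case True
    have shift: "stab_mat x y a b c \<in> J" if "stab_mat u w a b c \<in> J" for u w x y a b c
      using gl.subspace_add[OF J(1) that trans[of "x - u" "y - w"]] by (simp add: stab_mat_simps)
    (* M is membership of the sl_2 part; ade and adf are the actions of e and f on it. *)
    define M where "M a b c \<longleftrightarrow> stab_mat 0 0 a b c \<in> J" for a b c
    from True obtain u w a b c where uw: "stab_mat u w a b c \<in> J" and nz: "\<not> (a = 0 \<and> b = 0 \<and> c = 0)"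
      by metis
    have r: "M a b c" unfolding M_def using uw by (rule shift)
    have scale: "M (k * a) (k * b) (k * c)" if "M a b c" for a b c k
      using gl.subspace_scale[OF J(1) that[unfolded M_def], of k] by (simp add: M_def stab_mat_simps)
    have add: "M (a + a') (b + b') (c + c')" if "M a b c" "M a' b' c'" for a b c a' b' c'
      using gl.subspace_add[OF J(1) that[unfolded M_def]] by (simp add: M_def stab_mat_simps)
    have ade: "M c (- (2 * a)) 0" if "M a b c" for a b c
      using ideal'[of "stab_mat 0 0 a b c" 0 0 0 1 0] that by (simp add: M_def stab_mat_simps)
    have adf: "M (- b) 0 (2 * a)" if "M a b c" for a b c
      using ideal'[of "stab_mat 0 0 a b c" 0 0 0 0 1] that by (simp add: M_def stab_mat_simps)
    have "M 0 1 0 \<or> M 0 0 1"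
    proof (cases "c = 0")
      case False
      then show ?thesis using scale[OF ade[OF ade[OF r]], of "- (1 / (2 * c))"] by simp
    next
      case c: True
      show ?thesis
      proof (cases "b = 0")
        case False
        then show ?thesis using scale[OF adf[OF adf[OF r]], of "- (1 / (2 * b))"] by simp
      next
        case True
        then have "a \<noteq> 0" using c nz by simp
        then show ?thesis using scale[OF ade[OF r], of "- (1 / (2 * a))"] c by simp
      qed
    qed
    then have efh: "M 0 1 0 \<and> M 0 0 1 \<and> M 1 0 0"
    proof
      assume e: "M 0 1 0"
      have h: "M 1 0 0" using scale[OF adf[OF e], of "- 1"] by simp
      have "M 0 0 1" using scale[OF adf[OF h], of "1 / 2"] by simp
      with e h show ?thesis by simp
    next
      assume f: "M 0 0 1"
      have h: "M 1 0 0" using ade[OF f] by simp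
      have "M 0 1 0" using scale[OF ade[OF h], of "- (1 / 2)"] by simp
      with f h show ?thesis by simp
    qed
    have "M a b c" for a b c
      using add[OF add[OF scale[of 1 0 0 a] scale[of 0 1 0 b]] scale[of 0 0 1 c]] efh by simp
    then have all: "stab_mat u w a b c \<in> J" for u w a b c
      unfolding M_def by (rule shift)
    have "e1_stabilizer \<subseteq> J"
      using all by (auto elim!: e1_stabilizerE)
    then show ?thesis using J(2) by blast
  qed
qed

section \<open>Pairs of homomorphisms with bijective difference\<close>

text \<open>The shape in which a PA-structure is analysed. It is symmetric in \<open>F\<close> and \<open>H\<close> and stable under
  automorphisms of \<open>sl\<close>, which is what allows the normalizations below.\<close>

locale sl3_hom_pair = lie_algebra smul g
  for smul :: "complex \<Rightarrow> 'v::ab_group_add \<Rightarrow> 'v" and g :: "'v \<Rightarrow> 'v \<Rightarrow> 'v" +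
  fixes F H :: "'v \<Rightarrow> complex^3^3"
  assumes perfect: perfect
    and linear_F: "Vector_Spaces.linear smul matrix_scale F"
    and linear_H: "Vector_Spaces.linear smul matrix_scale H"
    and F_bracket: "F (g x y) = commutator (F x) (F y)"
    and H_bracket: "H (g x y) = commutator (H x) (H y)"
    and bij_diff: "bij_betw (\<lambda>x. H x - F x) UNIV sl"
begin

sublocale F: Vector_Spaces.linear smul matrix_scale F by (rule linear_F)
sublocale H: Vector_Spaces.linear smul matrix_scale H by (rule linear_H)

lemma swap: "sl3_hom_pair smul g H F"
proof (unfold_locales)
  have "bij_betw uminus sl (sl :: (complex^3^3) set)"
    by (rule bij_betw_byWitness[where f' = uminus]) (auto simp: sl_def trace_def sum_negf)
  from bij_betw_trans[OF bij_diff this]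
  show "bij_betw (\<lambda>x. F x - H x) UNIV sl"
    by (simp add: comp_def)
qed (simp_all add: perfect F_bracket H_bracket F.add F.scale H.add H.scale)

lemma compose_automorphism:
  assumes "sl_automorphism \<theta>"
  shows "sl3_hom_pair smul g (\<theta> \<circ> F) (\<theta> \<circ> H)"
proof -
  interpret \<theta>: Vector_Spaces.linear matrix_scale matrix_scale \<theta>
    using assms by (simp add: sl_automorphism_def)
  show ?thesis
  proof (unfold_locales)
    have "bij_betw \<theta> sl sl" using assms by (simp add: sl_automorphism_def)
    from bij_betw_trans[OF bij_diff this]
    show "bij_betw (\<lambda>x. (\<theta> \<circ> H) x - (\<theta> \<circ> F) x) UNIV sl"
      by (simp add: comp_def \<theta>.diff)
  qed (use assms in \<open>simp_all add: perfect F_bracket H_bracket F.add F.scale H.add H.scale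
      \<theta>.add \<theta>.scale sl_automorphism_def\<close>)
qed

lemma range_F_perfect: "range F = gl.bracket_span (range F) (range F)"
proof -
  have "span {g x y | x y. x \<in> UNIV \<and> y \<in> UNIV} = UNIV"
    using perfect unfolding perfect_def bracket_span_def .
  then have "range F = F ` span {g x y | x y. x \<in> UNIV \<and> y \<in> UNIV}"
    by (simp only:)
  also have "\<dots> = gl.span (F ` {g x y | x y. x \<in> UNIV \<and> y \<in> UNIV})"
    by (rule F.span_image[symmetric])
  also have "F ` {g x y | x y. x \<in> UNIV \<and> y \<in> UNIV} = {commutator a b | a b. a \<in> range F \<and> b \<in> range F}"
  proof (intro equalityI subsetI)
    fix A assume "A \<in> {commutator a b | a b. a \<in> range F \<and> b \<in> range F}"
    then obtain x y where "A = F (g x y)" by (auto simp: F_bracket)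
    then show "A \<in> F ` {g x y | x y. x \<in> UNIV \<and> y \<in> UNIV}" by blast
  next
    fix A assume "A \<in> F ` {g x y | x y. x \<in> UNIV \<and> y \<in> UNIV}"
    then obtain x y where "A = commutator (F x) (F y)" by (auto simp: F_bracket)
    then show "A \<in> {commutator a b | a b. a \<in> range F \<and> b \<in> range F}" by blast
  qed
  finally show ?thesis by (simp add: gl.bracket_span_def)
qed

lemma range_H_perfect: "range H = gl.bracket_span (range H) (range H)"
  by (rule sl3_hom_pair.range_F_perfect[OF swap])

lemma diff_eqD: "H x - F x = H y - F y \<Longrightarrow> x = y"
  using inj_onD[OF bij_betw_imp_inj_on[OF bij_diff]] by blast

lemma diff_onto_sl: "A \<in> sl \<Longrightarrow> \<exists>x. A = H x - F x"
  using bij_betw_imp_surj_on[OF bij_diff] by blast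

lemma diff_in_sl: "H x - F x \<in> sl"
  using bij_betw_imp_surj_on[OF bij_diff] by blast

text \<open>Transporting \<open>H\<close> back along the bijection \<open>H - F\<close> gives an endomorphism \<open>T\<close> of the Lie algebra
  with the same kernel, whose corank is the codimension of the range of \<open>H\<close> in \<open>sl\<close>.\<close>

lemma range_H_corank_le_2:
  assumes fin: "finite_dimensional_vector_space smul Bs"
    and ker: "{x. H x = 0} \<subseteq> span {l1, l2}"
  obtains Y1 Y2 where
    "\<And>A. A \<in> sl \<Longrightarrow> \<exists>B\<in>range H. \<exists>a b. A = B + matrix_scale a Y1 + matrix_scale b Y2"
    "{x. H x = 0} \<noteq> {0} \<Longrightarrow> range H \<noteq> sl"
proof -
  interpret fd: finite_dimensional_vector_space smul Bs by fact
  have "\<forall>x. \<exists>y. H x = H y - F y"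
  proof
    fix x
    have "H x \<in> sl" using perfect_subset_sl[OF range_H_perfect] by blast
    then show "\<exists>y. H x = H y - F y" by (rule diff_onto_sl)
  qed
  then obtain T where T: "\<And>x. H x = H (T x) - F (T x)" unfolding choice_iff by blast
  have lin: "Vector_Spaces.linear smul smul T"
  proof unfold_locales
    show "T (x + y) = T x + T y" for x y
    proof (rule diff_eqD)
      have "H (T (x + y)) - F (T (x + y)) = H x + H y" unfolding T[symmetric] by (rule H.add)
      also have "\<dots> = H (T x + T y) - F (T x + T y)"
        unfolding T[of x] T[of y] by (simp add: H.add F.add)
      finally show "H (T (x + y)) - F (T (x + y)) = H (T x + T y) - F (T x + T y)" .
    qed
    show "T (smul c x) = smul c (T x)" for c x
    proof (rule diff_eqD)
      have "H (T (smul c x)) - F (T (smul c x)) = matrix_scale c (H x)" unfolding T[symmetric] by (rule H.scale)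
      also have "\<dots> = H (smul c (T x)) - F (smul c (T x))"
        unfolding T[of x] by (simp add: H.scale F.scale gl.scale_right_diff_distrib)
      finally show "H (T (smul c x)) - F (T (smul c x)) = H (smul c (T x)) - F (smul c (T x))" .
    qed
  qed
  interpret T: Vector_Spaces.linear smul smul T by (rule lin)
  have kerT: "T x = 0 \<longleftrightarrow> H x = 0" for x
  proof
    assume "T x = 0"
    then show "H x = 0" using T[of x] by (simp add: H.zero F.zero)
  next
    assume "H x = 0"
    then have "H (T x) - F (T x) = H 0 - F 0" using T[of x] by (simp add: H.zero F.zero)
    then show "T x = 0" by (rule diff_eqD)
  qed
  obtain y1 y2 where y: "\<And>v. \<exists>x a b. v = T x + smul a y1 + smul b y2"
    using fd.corank_le_2[OF lin, of l1 l2] ker unfolding kerT by metis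
  show ?thesis
  proof (rule that)
    fix A :: "complex^3^3" assume "A \<in> sl"
    then obtain v where v: "A = H v - F v" using diff_onto_sl by blast
    from y obtain x a b where "v = T x + smul a y1 + smul b y2" by blast
    then have "A = H x + matrix_scale a (H y1 - F y1) + matrix_scale b (H y2 - F y2)"
      unfolding v T[of x]
      by (simp add: H.add F.add H.scale F.scale gl.scale_right_diff_distrib algebra_simps)
    then show "\<exists>B\<in>range H. \<exists>a b. A = B + matrix_scale a (H y1 - F y1) + matrix_scale b (H y2 - F y2)"
      by blast
  next
    assume ne: "{x. H x = 0} \<noteq> {0}"
    show "range H \<noteq> sl"
    proof
      assume eq: "range H = sl"
      have "\<exists>x. v = T x" for v
      proof -
        have "H v - F v \<in> range H" using diff_in_sl eq by simp
        then obtain x where "H v - F v = H x" by blast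
        also note T[of x]
        finally show ?thesis by (blast dest: diff_eqD)
      qed
      then have "surj T" by (simp add: surj_def)
      then have "inj T" using fd.linear_surj_imp_inj[OF lin] by blast
      then have "{x. H x = 0} = {0}" by (auto simp: kerT[symmetric] T.inj_iff_eq_0 T.zero)
      with ne show False by contradiction
    qed
  qed
qed

text \<open>If \<open>F\<close> does not kill \<open>I\<close>, its range is the whole stabilizer of the first basis vector. Let \<open>L\<close>
  be the kernel of \<open>H\<close>; on it \<open>F\<close> equals minus the bijection \<open>H - F\<close>, so \<open>F\<close> maps \<open>L\<close> injectively
  onto an ideal of the stabilizer. If that ideal is zero, \<open>H\<close> has corank zero and does not kill \<open>I\<close>.
  If it is the whole stabilizer, the range of \<open>H\<close> is a complement of the stabilizer in \<open>sl\<close> and is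
  therefore simply transitive. If it consists of the translations, the range of \<open>H\<close> has
  codimension two. All three are excluded by the obstructions for perfect subalgebras of \<open>sl\<close>.\<close>

lemma F_kills_abelian_ideal_in_e1_stabilizer:
  assumes fin: "finite_dimensional_vector_space smul Bs"
    and I: "lie_ideal I" "\<And>x y. x \<in> I \<Longrightarrow> y \<in> I \<Longrightarrow> g x y = 0"
    and stab: "range F \<subseteq> e1_stabilizer"
    and x: "x \<in> I"
  shows "F x = 0"
proof (rule ccontr)
  assume Fx: "F x \<noteq> 0"
  have subI: "subspace I" using I(1) by (simp add: lie_ideal_def)
  have idealI: "g b y \<in> I" if "y \<in> I" for b y
    using I(1) that by (simp add: lie_ideal_def)
  have range_F: "range F = e1_stabilizer"
  proof (rule perfect_in_e1_stabilizer_full)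
    show "gl.subspace (range F)" by (rule subspace_perfect[OF range_F_perfect])
    show "range F \<subseteq> gl.bracket_span (range F) (range F)" using range_F_perfect by simp
    show "gl.subspace (F ` I)" using subI by (rule F.subspace_image)
    show "commutator X Y = 0" if "X \<in> F ` I" "Y \<in> F ` I" for X Y
      using that I(2) by (auto simp: F_bracket[symmetric])
    show "commutator B X \<in> F ` I" if "B \<in> range F" "X \<in> F ` I" for B X
      using that idealI by (auto simp: F_bracket[symmetric])
  qed (use x Fx stab in auto)
  define L where "L = {x. H x = 0}"
  have subL: "subspace L" unfolding L_def by (rule H.subspace_kernel)
  have F_inj_L: "y = z" if "y \<in> L" "z \<in> L" "F y = F z" for y z
    using that by (intro diff_eqD) (simp add: L_def)
  have H_sl: "H y \<in> sl" for y using perfect_subset_sl[OF range_H_perfect] by blast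
  show False
  proof (cases "L = {0}")
    case True
    then have "{x. H x = 0} \<subseteq> span {0, 0}" by (simp add: L_def)
    then obtain Y1 Y2 where
      "\<And>A. A \<in> sl \<Longrightarrow> \<exists>B\<in>range H. \<exists>a b. A = B + matrix_scale a Y1 + matrix_scale b Y2"
      using range_H_corank_le_2[OF fin] by metis
    then have "H ` I \<subseteq> {0}"
    proof (rule no_abelian_normalized_if_corank_le_2[OF range_H_perfect])
      show "commutator X Y = 0" if "X \<in> H ` I" "Y \<in> H ` I" for X Y
        using that I(2) by (auto simp: H_bracket[symmetric] H.zero)
      show "commutator B X \<in> H ` I" if "B \<in> range H" "X \<in> H ` I" for B X
        using that idealI by (auto simp: H_bracket[symmetric])
      show "H ` I \<subseteq> sl" using H_sl by blast
    qed
    then have "x \<in> L" using x by (auto simp: L_def)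
    with True Fx show False by (simp add: F.zero)
  next
    case False
    have sub_J: "gl.subspace (F ` L)" using subL by (rule F.subspace_image)
    have ne_J: "\<not> F ` L \<subseteq> {0}"
    proof
      assume "F ` L \<subseteq> {0}"
      then have "y = 0" if "y \<in> L" for y
        using F_inj_L[of y 0] that by (auto simp: L_def F.zero H.zero)
      then show False using False subspace_0[OF subL] by blast
    qed
    have J: "F ` L = e1_stabilizer \<or> F ` L = {stab_mat u w 0 0 0 | u w. True}"
    proof (rule e1_stabilizer_ideals[OF sub_J _ ne_J])
      show "F ` L \<subseteq> e1_stabilizer" using stab by blast
      fix B X :: "complex^3^3" assume "B \<in> e1_stabilizer" "X \<in> F ` L"
      then obtain b y where b: "B = F b" and y: "y \<in> L" "X = F y" using range_F by blast
      have "g b y \<in> L" using y(1) by (simp add: L_def H_bracket gl.bracket_simps)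
      then show "commutator B X \<in> F ` L" by (auto simp: b y F_bracket[symmetric])
    qed
    then show False
    proof
      assume J: "F ` L = e1_stabilizer"
      have "bij_betw (\<lambda>A. A *v axis 1 1) (range H) UNIV"
        unfolding bij_betw_def
      proof
        (* Subtracting from z an element of L with the same F-value makes H z a value of H - F on the
           kernel of F; as H z also lies in F(L), the bijection H - F forces H z = 0. *)
        have kernel: "H z = 0" if z: "H z *v axis 1 1 = 0" for z
        proof -
          have "F z \<in> F ` L" using J stab by blast
          then obtain l where l: "l \<in> L" "F z = F l" by blast
          have "H z \<in> F ` L" using z H_sl J by (auto simp: e1_stabilizer_def)
          then obtain l' where l': "l' \<in> L" "H z = F l'" by blast
          have "z - l = - l'"
            by (rule diff_eqD)
              (use l l' in \<open>simp add: H.diff F.diff H.neg F.neg L_def\<close>)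
          then have "H z = H l - H l'"
            by (metis H.diff H.add diff_add_cancel uminus_add_conv_diff)
          then show ?thesis using l l' by (simp add: L_def)
        qed
        show "inj_on (\<lambda>A. A *v axis 1 1) (range H)"
        proof (rule inj_onI)
          fix A B assume "A \<in> range H" "B \<in> range H" and eq: "A *v axis 1 1 = B *v axis 1 1"
          then obtain y z where yz: "A = H y" "B = H z" by blast
          have "H (y - z) = 0"
            by (rule kernel) (use eq in \<open>simp add: yz H.diff matrix_vector_mult_diff_rdistrib\<close>)
          then show "A = B" by (simp add: yz H.diff)
        qed
        show "(\<lambda>A. A *v axis 1 1) ` range H = UNIV"
        proof (rule equalityI[OF subset_UNIV subsetI])
          fix w :: "complex^3"
          obtain A where A: "A \<in> sl" "A *v axis 1 1 = w" by (rule sl_transitive)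
          then obtain y where y: "A = H y - F y" using diff_onto_sl by blast
          have "F y *v axis 1 1 = 0" using stab by (auto simp: e1_stabilizer_def)
          then have "w = H y *v axis 1 1" using A y by (simp add: matrix_vector_mult_diff_rdistrib)
          then show "w \<in> (\<lambda>A. A *v axis 1 1) ` range H" by blast
        qed
      qed
      then show False
        by (rule perfect_not_simply_transitive[OF range_H_perfect])
    next
      assume J: "F ` L = {stab_mat u w 0 0 0 | u w. True}"
      then have "stab_mat 1 0 0 0 0 \<in> F ` L" "stab_mat 0 1 0 0 0 \<in> F ` L" by blast+
      then obtain l1 l2 where l: "l1 \<in> L" "l2 \<in> L" "F l1 = stab_mat 1 0 0 0 0" "F l2 = stab_mat 0 1 0 0 0"
        by (metis imageE)
      have "L \<subseteq> span {l1, l2}"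
      proof
        fix y assume y: "y \<in> L"
        then obtain u w where "F y = stab_mat u w 0 0 0" using J by blast
        then have "F y = F (smul u l1 + smul w l2)"
          by (simp add: F.add F.scale l stab_mat_simps)
        then have "y = smul u l1 + smul w l2"
          by (intro F_inj_L y subspace_add[OF subL] subspace_scale[OF subL] l)
        then show "y \<in> span {l1, l2}"
          by (simp add: span_add span_scale span_base)
      qed
      then obtain Y1 Y2 where Y:
        "\<And>A. A \<in> sl \<Longrightarrow> \<exists>B\<in>range H. \<exists>a b. A = B + matrix_scale a Y1 + matrix_scale b Y2"
        and proper: "range H \<noteq> sl"
        using range_H_corank_le_2[OF fin, of l1 l2] False unfolding L_def by metis
      show False
        using no_perfect_subalgebra_of_corank_le_2[OF range_H_perfect proper Y] .
    qed
  qed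
qed

lemma F_kills_abelian_ideal:
  assumes fin: "finite_dimensional_vector_space smul Bs"
    and I: "lie_ideal I" "\<And>x y. x \<in> I \<Longrightarrow> y \<in> I \<Longrightarrow> g x y = 0"
    and x: "x \<in> I"
  shows "F x = 0"
proof (rule ccontr)
  assume Fx: "F x \<noteq> 0"
  have F_sl: "range F \<subseteq> sl" by (rule perfect_subset_sl[OF range_F_perfect])
  have "\<exists>\<theta>. sl_automorphism \<theta> \<and> (\<forall>B\<in>range F. \<theta> B *v axis 1 1 = 0)"
  proof (rule perfect_with_abelian_normalized_kills_vector[of "range F" "F ` I"])
    show "range F \<subseteq> gl.bracket_span (range F) (range F)" using range_F_perfect by simp
    show "commutator X Y = 0" if "X \<in> F ` I" "Y \<in> F ` I" for X Y
      using that I(2) by (auto simp: F_bracket[symmetric] F.zero)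
    show "commutator B X \<in> F ` I" if "B \<in> range F" "X \<in> F ` I" for B X
      using that I(1) by (auto simp: F_bracket[symmetric] lie_ideal_def)
    show "F ` I \<subseteq> sl" using F_sl by blast
    show "\<not> F ` I \<subseteq> {0}" using x Fx by blast
  qed blast
  then obtain \<theta> where \<theta>: "sl_automorphism \<theta>" "\<And>x. \<theta> (F x) *v axis 1 1 = 0" by blast
  interpret \<theta>: Vector_Spaces.linear matrix_scale matrix_scale \<theta>
    using \<theta> by (simp add: sl_automorphism_def)
  interpret \<theta>F: sl3_hom_pair smul g "\<theta> \<circ> F" "\<theta> \<circ> H"
    by (rule compose_automorphism[OF \<theta>(1)])
  have bij: "bij_betw \<theta> sl sl" using \<theta>(1) by (simp add: sl_automorphism_def)
  have "(\<theta> \<circ> F) x = 0"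
  proof (rule \<theta>F.F_kills_abelian_ideal_in_e1_stabilizer[OF fin I _ x])
    show "range (\<theta> \<circ> F) \<subseteq> e1_stabilizer"
      using F_sl bij \<theta>(2) by (auto simp: e1_stabilizer_def bij_betw_def)
  qed
  then have "\<theta> (F x) = \<theta> 0" by (simp add: \<theta>.zero)
  moreover have "F x \<in> sl" "(0 :: complex^3^3) \<in> sl" using F_sl by (auto simp: sl_def trace_def)
  ultimately have "F x = 0" using inj_onD[OF bij_betw_imp_inj_on[OF bij]] by blast
  with Fx show False by contradiction
qed

text \<open>By symmetry both \<open>F\<close> and \<open>H\<close> kill every abelian ideal, hence so does the bijection \<open>H - F\<close>.\<close>

theorem semisimple_if_hom_pair:
  assumes fin: "finite_dimensional_vector_space smul Bs"
  shows semisimple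
proof (rule ccontr)
  assume "\<not> semisimple"
  then obtain I where I: "lie_ideal I" "I \<noteq> {0}" "\<And>x y. x \<in> I \<Longrightarrow> y \<in> I \<Longrightarrow> g x y = 0"
    using abelian_ideal_if_not_semisimple by metis
  then obtain x where x: "x \<in> I" "x \<noteq> 0" using subspace_0 unfolding lie_ideal_def by blast
  have "F x = 0" using F_kills_abelian_ideal[OF fin I(1,3) x(1)] .
  moreover have "H x = 0" using sl3_hom_pair.F_kills_abelian_ideal[OF swap fin I(1,3) x(1)] .
  ultimately have "x = 0" by (intro diff_eqD) (simp add: F.zero H.zero)
  with x show False by simp
qed

end

section \<open>Post-Lie algebra structures\<close>

text \<open>The Casimir operator kills a matrix that commutes with all others, and multiplies a traceless
  one by \<open>2n\<close>.\<close>

lemma sl_centralizer_trivial: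
  fixes C :: "'a::field_char_0^'n^'n"
  assumes C: "C \<in> sl" and comm: "\<And>A. A \<in> sl \<Longrightarrow> commutator C A = 0"
  shows "C = 0"
proof -
  have "commutator C A = 0" for A
  proof -
    have "commutator C (A - matrix_scale (trace A / of_nat CARD('n)) (mat 1)) = 0"
      by (rule comm[OF traceless_part_in_sl])
    moreover have "commutator C (mat 1) = 0" by (simp add: commutator_def)
    ultimately show ?thesis by (simp add: gl.bracket_simps)
  qed
  then have "(0 :: 'a^'n^'n) = matrix_scale (2 * of_nat CARD('n)) C - matrix_scale (2 * trace C) (mat 1)"
    using gl_casimir[of C] by (simp add: gl.bracket_simps)
  then show ?thesis using C by (simp add: sl_def)
qed

text \<open>Let \<open>f\<close> be the isomorphism of \<open>n\<close> with \<open>sl\<close>. Left multiplication by \<open>x\<close> is a derivation of \<open>n\<close>,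
  hence inner: \<open>f(x \<cdot> y) = [F x, f y]\<close> for a unique traceless \<open>F x\<close>. The second PA-axiom says that
  \<open>F\<close> is a homomorphism on \<open>g\<close>, and the first one then says the same of \<open>F + f\<close>.\<close>

lemma PA_structure_gives_hom_pair:
  fixes smul :: "complex \<Rightarrow> 'v::ab_group_add \<Rightarrow> 'v" and g n :: "'v \<Rightarrow> 'v \<Rightarrow> 'v"
  assumes g: "lie_algebra smul g" "lie_algebra.perfect smul g"
    and n: "lie_algebra smul n"
    and iso: "lie_isomorphic smul UNIV n matrix_scale (sl :: (complex^3^3) set) commutator"
    and PA: "PA_structure smul g n p"
  obtains F H where "sl3_hom_pair smul g F H"
proof -
  interpret g: lie_algebra smul g by fact
  obtain f where bij: "bij_betw f UNIV (sl :: (complex^3^3) set)"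
    and f_add: "\<And>x y. f (x + y) = f x + f y" and f_scale: "\<And>c x. f (smul c x) = matrix_scale c (f x)"
    and f_n: "\<And>x y. f (n x y) = commutator (f x) (f y)"
    using iso unfolding lie_isomorphic_def by auto
  interpret f: Vector_Spaces.linear smul matrix_scale f
    by unfold_locales (rule f_add f_scale)+
  have f_sl: "f x \<in> sl" for x using bij_betw_imp_surj_on[OF bij] by blast
  have f_eqD: "x = y" if "f x = f y" for x y
    using inj_onD[OF bij_betw_imp_inj_on[OF bij]] that by blast
  have p_lin: "Vector_Spaces.linear smul smul (p x)" "Vector_Spaces.linear smul smul (\<lambda>x. p x y)"
    and p1: "p x y - p y x = g x y - n x y"
    and p2: "p (g x y) z = p x (p y z) - p y (p x z)"
    and p3: "p x (n y z) = n (p x y) z + n y (p x z)" for x y z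
    using PA unfolding PA_structure_def bilinear_over_def by blast+
  interpret pl: Vector_Spaces.linear smul smul "p x" for x by (rule p_lin)
  interpret pr: Vector_Spaces.linear smul smul "\<lambda>x. p x y" for y by (rule p_lin)
  (* Derivations are extended from sl to all matrices through the traceless part tl, which does not
     change commutators. *)
  define tl :: "complex^3^3 \<Rightarrow> complex^3^3" where "tl A = A - matrix_scale (trace A / 3) (mat 1)" for A
  have tl_sl: "tl A \<in> sl" for A
    using traceless_part_in_sl[of A] by (simp add: tl_def)
  have "\<forall>A. \<exists>x. f x = tl A"
  proof
    fix A
    have "tl A \<in> range f" using tl_sl bij_betw_imp_surj_on[OF bij] by simp
    then show "\<exists>x. f x = tl A" by force
  qed
  then obtain \<iota> where \<iota>: "\<And>A. f (\<iota> A) = tl A" unfolding choice_iff by blast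
  have comm_tl: "commutator (tl A) B = commutator A B" "commutator A (tl B) = commutator A B" for A B
  proof -
    have "commutator (mat 1) B = 0" "commutator A (mat 1) = 0" by (simp_all add: commutator_def)
    then show "commutator (tl A) B = commutator A B" "commutator A (tl B) = commutator A B"
      by (simp_all add: tl_def gl.bracket_simps)
  qed
  have tl_add: "tl (A + B) = tl A + tl B" for A B
    by (simp add: tl_def trace_add add_divide_distrib gl.scale_left_distrib)
  have tl_scale: "tl (matrix_scale c A) = matrix_scale c (tl A)" for c A
    by (simp add: tl_def trace_matrix_scale gl.scale_right_diff_distrib)
  have tl_id: "tl A = A" if "A \<in> sl" for A using that by (simp add: tl_def sl_def)
  have \<iota>_add: "\<iota> (A + B) = \<iota> A + \<iota> B" for A B
    by (rule f_eqD) (simp add: \<iota> f_add tl_add)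
  have \<iota>_scale: "\<iota> (matrix_scale c A) = smul c (\<iota> A)" for c A
    by (rule f_eqD) (simp add: \<iota> f_scale tl_scale)
  have \<iota>_comm: "\<iota> (commutator A B) = n (\<iota> A) (\<iota> B)" for A B
    by (rule f_eqD) (simp add: \<iota> f_n comm_tl tl_id commutator_in_sl)
  have \<iota>_f: "\<iota> (f x) = x" for x
    by (rule f_eqD) (simp add: \<iota> tl_id f_sl)
  (* 6 = 2n for n = 3 is the scalar by which the Casimir operator acts. *)
  define F where "F x = matrix_scale (1 / 6)
    (\<Sum>i\<in>UNIV. \<Sum>j\<in>UNIV. commutator (f (p x (\<iota> (matrix_unit i j)))) (matrix_unit j i))" for x
  have F_p: "commutator (F x) (f y) = f (p x y)" for x y
  proof -
    let ?D = "\<lambda>A. f (p x (\<iota> A))"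
    have lin: "Vector_Spaces.linear matrix_scale matrix_scale ?D"
      by unfold_locales (simp_all add: \<iota>_add \<iota>_scale pl.add pl.scale f_add f_scale)
    have der: "?D (commutator A B) = commutator (?D A) B + commutator A (?D B)" for A B
      by (simp add: \<iota>_comm p3 f_add f_n \<iota> comm_tl)
    have tr: "trace (?D A) = 0" for A using f_sl[of "p x (\<iota> A)"] by (simp add: sl_def)
    show ?thesis
      using derivation_of_gl_inner[OF lin der tr, of "f y"] by (simp add: F_def gl.bracket_simps \<iota>_f)
  qed
  have F_sl: "F x \<in> sl" for x
    unfolding F_def
    by (intro gl.subspace_scale[OF subspace_sl] gl.subspace_sum[OF subspace_sl] commutator_in_sl)
  have F_unique: "F x = C" if "C \<in> sl" "\<And>y. commutator C (f y) = f (p x y)" for x C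
  proof -
    have "F x - C = 0"
    proof (rule sl_centralizer_trivial)
      show "F x - C \<in> sl" using gl.subspace_diff[OF subspace_sl F_sl that(1)] .
      fix A :: "complex^3^3" assume "A \<in> sl"
      then have "A \<in> range f" using bij_betw_imp_surj_on[OF bij] by simp
      then obtain y where "A = f y" by blast
      then show "commutator (F x - C) A = 0" by (simp add: gl.bracket_simps F_p that(2))
    qed
    then show ?thesis by simp
  qed
  have F_add: "F (x + y) = F x + F y" for x y
    by (rule F_unique)
      (simp_all add: gl.subspace_add[OF subspace_sl] F_sl gl.bracket_simps F_p pr.add f_add)
  have F_scale: "F (smul c x) = matrix_scale c (F x)" for c x
    by (rule F_unique)
      (simp_all add: gl.subspace_scale[OF subspace_sl] F_sl gl.bracket_simps F_p pr.scale f_scale)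
  have F_g: "F (g x y) = commutator (F x) (F y)" for x y
  proof (rule F_unique)
    fix z
    have "commutator (commutator (F x) (F y)) (f z)
        = commutator (F x) (commutator (F y) (f z)) - commutator (F y) (commutator (F x) (f z))"
      by (simp add: gl.ad_derivation[of "F x"])
    then show "commutator (commutator (F x) (F y)) (f z) = f (p (g x y) z)"
      by (simp add: F_p p2 f.diff)
  qed (rule commutator_in_sl)
  have f_g: "f (g x y) = commutator (f x) (f y) + commutator (F x) (f y) + commutator (f x) (F y)" for x y
  proof -
    have "g x y = n x y + p x y - p y x" using p1[of x y] by (simp add: algebra_simps)
    then show ?thesis
      using commutator_antisym[of "f x" "F y"] by (simp add: f_add f.diff f_n F_p)
  qed
  have "sl3_hom_pair smul g F (\<lambda>x. F x + f x)"
  proof unfold_locales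
    show "bij_betw (\<lambda>x. F x + f x - F x) UNIV sl" using bij by simp
    show "F (g x y) + f (g x y) = commutator (F x + f x) (F y + f y)" for x y
      by (simp add: F_g f_g gl.bracket_simps)
  qed (simp_all add: g F_add F_scale F_g f_add f_scale gl.scale_right_distrib)
  then show ?thesis by (rule that)
qed

theorem theorem3p10:
  fixes smul :: "complex \<Rightarrow> 'v::ab_group_add \<Rightarrow> 'v"
    and Basis :: "'v set"
    and g n :: "'v \<Rightarrow> 'v \<Rightarrow> 'v"
  assumes "finite_dimensional_vector_space smul Basis"
    and "lie_algebra smul g"
    and "lie_algebra smul n"
    and "lie_algebra.perfect smul g"
    and "\<not> lie_algebra.semisimple smul g"
    and "lie_isomorphic smul UNIV n matrix_scale (sl :: (complex^3^3) set) commutator"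
  shows "\<not> (\<exists>p. PA_structure smul g n p)"
proof
  assume "\<exists>p. PA_structure smul g n p"
  then obtain p where "PA_structure smul g n p" by blast
  then obtain F H where "sl3_hom_pair smul g F H"
    using PA_structure_gives_hom_pair assms(2,3,4,6) by metis
  then have "lie_algebra.semisimple smul g"
    using assms(1) by (rule sl3_hom_pair.semisimple_if_hom_pair)
  with assms(5) show False by contradiction
qed

end
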